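(* Let $\mathcal{C}$ be a $d$-uniform properly-connected triangulated hypergraph on $V$. Then: (i) there exists an edge $F$ of $\mathcal{C}$ such that $\operatorname{conn_h}(\operatorname{Ind}(\mathcal{C}:F))\ge \operatorname{conn_h}(\operatorname{Ind}(\mathcal{C}))-|F|+1$; (ii) $\operatorname{Ind}(\mathcal{C})$ is either contractible or homotopy equivalent to a wedge of spheres each of dimension at most $(d-1)\operatorname{c}_{\mathcal{C}}-1$, where $\operatorname{c}_{\mathcal{C}}$ is the maximum number of pairwise $(d+1)$-disjoint edges of $\mathcal{C}$.
   Context: A hypergraph $\mathcal{C}$ on a finite vertex set $V$ is a family of pairwise incomparable subsets of $V$ (its edges), each of cardinality at least $2$; it is $d$-uniform if every edge has $d$ elements. $\operatorname{Ind}(\mathcal{C})$ is the simplicial complex on $V$ of subsets containing no edge. For an edge $F$: $N_{\mathcal{C}}(F)=\bigcup\{E\setminus F : E\in\mathcal{C},\ |E\setminus F|=1\}$, and $\mathcal{C}:F$ is the hypergraph on $V\setminus(F\cup N_{\mathcal{C}}(F))$ whose edges are the members of cardinality at least $2$ among the inclusion-minimal members of $\{E\setminus F: E\in\mathcal{C},E\neq F\}$. For $A\subseteq V$, the induced subhypergraph $\mathcal{C}_A=\{E\in\mathcal{C}: E\subseteq A\}$ on $A$. Two distinct vertices are neighbours if some edge contains both; $N_{\mathcal{C}}(x)$ is the set of neighbours of $x$. The $d$-complete hypergraph of order $m$ has as edges all $d$-subsets of its $m$-element vertex set (no edges if $m<d$). Given edges $F,G$ with $|F|\ge |G|$, a proper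 chain from $F$ to $G$ is a sequence $(E_0=F,x_1,E_1,x_2,\dots,x_n,E_n=G)$ with distinct vertices $x_i$ and distinct edges $E_j$ such that $x_1\in E_0$, $x_n\in E_n$, $x_k,x_{k+1}\in E_k$ for $k=1,\dots,n-1$, and $|E_i\cap E_{i+1}|=|E_{i+1}|-1$ for $i=0,\dots,n-1$; its length is $n$. It is irredundant if no subsequence of it is a proper chain from $F$ to $G$. The distance $\operatorname{dist}_{\mathcal{C}}(F,G)$ is the minimum length of a proper irredundant chain from $F$ to $G$. A $d$-uniform hypergraph is properly-connected if $\operatorname{dist}_{\mathcal{C}}(F,G)=d-|F\cap G|$ for any two edges with $F\cap G\neq\emptyset$. A set of edges is pairwise $t$-disjoint if any two of its distinct members have distance at least $t$. A $d$-uniform properly-connected hypergraph $\mathcal{C}$ on $V$ is triangulated if for every nonempty $A\subseteq V$ there is a vertex $v\in A$ such that $N_{\mathcal{C}_A}(v)$ induces (in $\mathcal{C}_A$) a $d$-complete hypergraph of order $|N_{\mathcal{C}_A}(v)|$ and $v$ appears at most twice in any proper irredundant chain in $\mathcal{C}_A$. $\operatorname{conn_h}(\Delta)$ is the largest $k$ such that $\tilde H_i(\Delta;\mathbb{Z})=0$ for all $i\le k$ ($\infty$ if all vanish; $\operatorname{conn_h}(\{\emptyset\})=-2$).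
   Formalization: The hypergraph is additionally assumed to have at least one edge; without edges, part (i) fails since it asserts that an edge exists. *)

theory Defs
  imports "HOL-Homology.Homology" "HOL-Library.Extended_Nat" "HOL-Library.Extended_Real"
begin

definition hypergraph :: "'a set \<Rightarrow> 'a set set \<Rightarrow> bool" where
  "hypergraph V C \<longleftrightarrow> finite V \<and> (\<forall>E\<in>C. E \<subseteq> V \<and> 2 \<le> card E)
     \<and> (\<forall>E\<in>C. \<forall>F\<in>C. E \<subseteq> F \<longrightarrow> E = F)"

definition uniform :: "nat \<Rightarrow> 'a set set \<Rightarrow> bool" where
  "uniform d C \<longleftrightarrow> (\<forall>E\<in>C. card E = d)"

definition Ind :: "'a set \<Rightarrow> 'a set set \<Rightarrow> 'a set set" where
  "Ind V C = {S. S \<subseteq> V \<and> \<not> (\<exists>E\<in>C. E \<subseteq> S)}"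

definition edge_nbhd :: "'a set set \<Rightarrow> 'a set \<Rightarrow> 'a set" where
  "edge_nbhd C F = \<Union>{E - F | E. E \<in> C \<and> card (E - F) = 1}"

definition colon_edges :: "'a set set \<Rightarrow> 'a set \<Rightarrow> 'a set set" where
  "colon_edges C F =
     (let M = {E - F | E. E \<in> C \<and> E \<noteq> F}
      in {S \<in> M. (\<forall>T\<in>M. T \<subseteq> S \<longrightarrow> T = S) \<and> 2 \<le> card S})"

definition colon_vertices :: "'a set \<Rightarrow> 'a set set \<Rightarrow> 'a set \<Rightarrow> 'a set" where
  "colon_vertices V C F = V - (F \<union> edge_nbhd C F)"

definition induced :: "'a set set \<Rightarrow> 'a set \<Rightarrow> 'a set set" where
  "induced C A = {E \<in> C. E \<subseteq> A}"

definition vnbhd :: "'a set set \<Rightarrow> 'a \<Rightarrow> 'a set" where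
  "vnbhd C x = {y. y \<noteq> x \<and> (\<exists>E\<in>C. x \<in> E \<and> y \<in> E)}"

fun interleave :: "'b list \<Rightarrow> 'a list \<Rightarrow> ('b + 'a) list" where
  "interleave [] _ = []"
| "interleave (E # Es) [] = [Inl E]"
| "interleave (E # Es) (x # xs) = Inl E # Inr x # interleave Es xs"

text \<open>The chain (E_0, x_1, E_1, ..., x_n, E_n) is represented by the edge list
  Es = [E_0,...,E_n] and the vertex list xs = [x_1,...,x_n].\<close>
definition proper_chain :: "'a set set \<Rightarrow> 'a set \<Rightarrow> 'a set \<Rightarrow> 'a set list \<Rightarrow> 'a list \<Rightarrow> bool" where
  "proper_chain C F G Es xs \<longleftrightarrow>
     F \<in> C \<and> G \<in> C \<and> card G \<le> card F \<and>
     length Es = length xs + 1 \<and> set Es \<subseteq> C \<and> distinct Es \<and> distinct xs \<and>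
     hd Es = F \<and> last Es = G \<and>
     (\<forall>i < length xs. xs ! i \<in> Es ! i \<and> xs ! i \<in> Es ! (i + 1)) \<and>
     (\<forall>i < length xs. card (Es ! i \<inter> Es ! (i + 1)) = card (Es ! (i + 1)) - 1)"

definition irredundant_chain :: "'a set set \<Rightarrow> 'a set \<Rightarrow> 'a set \<Rightarrow> 'a set list \<Rightarrow> 'a list \<Rightarrow> bool" where
  "irredundant_chain C F G Es xs \<longleftrightarrow> proper_chain C F G Es xs \<and>
     \<not> (\<exists>Es' xs'. proper_chain C F G Es' xs' \<and>
          interleave Es' xs' \<in> set (subseqs (interleave Es xs)) \<and>
          interleave Es' xs' \<noteq> interleave Es xs)"

text \<open>Distance; \<infinity> if there is no proper irredundant chain.\<close>
definition hdist :: "'a set set \<Rightarrow> 'a set \<Rightarrow> 'a set \<Rightarrow> enat" where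
  "hdist C F G = (INF n \<in> {length xs | Es xs. irredundant_chain C F G Es xs}. enat n)"

definition properly_connected :: "nat \<Rightarrow> 'a set set \<Rightarrow> bool" where
  "properly_connected d C \<longleftrightarrow> uniform d C \<and>
     (\<forall>F\<in>C. \<forall>G\<in>C. F \<inter> G \<noteq> {} \<longrightarrow> hdist C F G = enat (d - card (F \<inter> G)))"

definition pairwise_disjoint_dist :: "'a set set \<Rightarrow> nat \<Rightarrow> 'a set set \<Rightarrow> bool" where
  "pairwise_disjoint_dist C t S \<longleftrightarrow>
     (\<forall>F\<in>S. \<forall>G\<in>S. F \<noteq> G \<longrightarrow> enat t \<le> hdist C F G)"

definition max_disjoint :: "nat \<Rightarrow> 'a set set \<Rightarrow> nat" where
  "max_disjoint d C = Max {card S | S. S \<subseteq> C \<and> pairwise_disjoint_dist C (d + 1) S}"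

definition triangulated :: "'a set \<Rightarrow> nat \<Rightarrow> 'a set set \<Rightarrow> bool" where
  "triangulated V d C \<longleftrightarrow> uniform d C \<and> properly_connected d C \<and>
     (\<forall>A. A \<subseteq> V \<and> A \<noteq> {} \<longrightarrow>
        (\<exists>v\<in>A.
           induced (induced C A) (vnbhd (induced C A) v)
             = {S. S \<subseteq> vnbhd (induced C A) v \<and> card S = d}
         \<and> (\<forall>F G Es xs. irredundant_chain (induced C A) F G Es xs \<longrightarrow>
               length (filter (\<lambda>E. v \<in> E) Es) \<le> 2)))"

definition realization :: "'a set \<Rightarrow> 'a set set \<Rightarrow> ('a \<Rightarrow> real) topology" where
  "realization V K = subtopology (product_topology (\<lambda>_. euclideanreal) V)
     {x \<in> extensional V. (\<forall>v\<in>V. 0 \<le> x v) \<and> sum x V = 1 \<and> {v \<in> V. x v \<noteq> 0} \<in> K}"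

text \<open>Vanishing of the i-th reduced homology group (integer coefficients).
  The only complex with empty realization is {\<emptyset>}, whose reduced homology is Z in
  degree -1 and zero otherwise.\<close>
definition rhom_vanishes :: "'a set \<Rightarrow> 'a set set \<Rightarrow> int \<Rightarrow> bool" where
  "rhom_vanishes V K i \<longleftrightarrow>
     (if topspace (realization V K) = {} then i \<noteq> -1
      else trivial_group (reduced_homology_group i (realization V K)))"

definition conn_h :: "'a set \<Rightarrow> 'a set set \<Rightarrow> ereal" where
  "conn_h V K = Sup {ereal (of_int k) | k. \<forall>i \<le> k. rhom_vanishes V K i}"

text \<open>Wedge of spheres of dimensions ns ! 0, ..., ns ! (m-1): sphere i lives in the
  coordinates (i, 0..ns!i), centred at the unit vector e_(i,0), so all pass through 0.
  The empty wedge is a point.\<close>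
definition wedge_of_spheres :: "nat list \<Rightarrow> (nat \<times> nat \<Rightarrow> real) topology" where
  "wedge_of_spheres ns = subtopology (product_topology (\<lambda>_. euclideanreal) UNIV)
     (insert (\<lambda>_. 0) (\<Union>i < length ns.
        {x. (\<forall>p. p \<notin> {i} \<times> {0..ns ! i} \<longrightarrow> x p = 0) \<and>
            (x (i, 0) - 1)\<^sup>2 + (\<Sum>j \<in> {1..ns ! i}. (x (i, j))\<^sup>2) = 1}))"

end

theory Submission
  imports Defs "HOL-Analysis.Abstract_Topological_Spaces"
begin

text \<open>Let \<open>v\<close> be a vertex of \<open>A\<close> as provided by the triangulation property. Two edges through \<open>v\<close>
  share all but one vertex, and their union without \<open>v\<close> is again an edge. Hence the faces of
  \<open>Ind A C\<close> that cannot be extended by \<open>v\<close> split into disjoint families, one for each edge \<open>E\<close>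
  through \<open>v\<close>, that consist of the sets \<open>(E - {v}) \<union> g\<close> with \<open>g\<close> a face of the independence complex
  of \<open>A - (E \<union> edge_nbhd C E)\<close>; the remaining faces form a cone over \<open>v\<close>. By induction, removing a
  suitable set of facets from \<open>Ind A C\<close> leaves a collapsible complex, each removed facet has
  \<open>(d - 1) * m\<close> vertices with \<open>m\<close> the size of a pairwise \<open>(d + 1)\<close>-disjoint set of edges, and every
  facet \<open>g\<close> removed for \<open>C : E\<close> gives a facet with \<open>d - 1\<close> more vertices removed for \<open>C\<close>.
  Collapsing the contractible complex yields a wedge of spheres, one for each removed facet, and
  both claims are read off from the dimensions of these spheres.\<close>

section \<open>Void-collapsible families\<close>

text \<open>Two edges \<open>E\<close>, \<open>G\<close> through \<open>v\<close> share all but one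
  vertex for the following reason. A chain of the least possible length
  \<open>d - card (E \<inter> G)\<close> between them keeps all its edges between
  \<open>E \<inter> G\<close> and \<open>E \<union> G\<close>, so every edge of it contains
  \<open>v\<close>; as \<open>v\<close> may occur only twice, the chain has just two edges. The
  induction runs over vertex sets \<open>A\<close> with \<open>C\<close> fixed. This works because
  an edge other than \<open>F\<close> that meets \<open>F\<close> also meets
  \<open>edge_nbhd C F\<close>, which makes \<open>C : F\<close> an induced subhypergraph of
  \<open>C\<close>. All distances are measured in \<open>C\<close>. The recursion may exhaust the
  vertices. The complex that remains then is \<open>{{}}\<close>, whose only face has to be removed,
  and this is why the empty face takes part in the bookkeeping. For the first claim it is enough to
  bound the connectivity from below for \<open>C : F\<close> and from above for \<open>C\<close>, so
  facets have to be carried in one direction only. The shift \<open>card F - 1\<close> is the size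
  of \<open>F - {v}\<close>.\<close>

text \<open>The empty face counts as a face, so that the last pair removed is \<open>{}\<close> and a vertex: a
  nonempty void-collapsible complex is collapsible in the usual sense.\<close>

inductive void_collapsible :: "'a set set \<Rightarrow> bool" where
  empty: "void_collapsible {}"
| pair: "void_collapsible K \<Longrightarrow> x \<notin> s \<Longrightarrow> (\<And>t. t \<in> K \<Longrightarrow> \<not> s \<subseteq> t)
          \<Longrightarrow> void_collapsible (insert s (insert (insert x s) K))"

text \<open>Adding \<open>T\<close> turns a removable pair of \<open>M\<close> into a removable pair
  of the union: a face of \<open>K\<close> above \<open>T \<union> s\<close> would contain
  \<open>T\<close>, and \<open>T \<union> g\<close> lies above it only if \<open>g\<close> contains
  \<open>s\<close>. The copy of \<open>M\<close> is dismantled before \<open>K\<close>.\<close>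

lemma void_collapsible_glue:
  assumes "void_collapsible M" "void_collapsible K"
    and "\<And>g. g \<in> M \<Longrightarrow> g \<inter> T = {}" and "\<And>t. t \<in> K \<Longrightarrow> \<not> T \<subseteq> t"
  shows "void_collapsible (K \<union> (\<lambda>g. T \<union> g) ` M)"
  using assms(1,3)
proof (induction rule: void_collapsible.induct)
  case empty
  then show ?case using assms(2) by simp
next
  case (pair M x s)
  have sub: "K \<union> (\<lambda>g. T \<union> g) ` insert s (insert (insert x s) M)
     = insert (T \<union> s) (insert (insert x (T \<union> s)) (K \<union> (\<lambda>g. T \<union> g) ` M))"
    by auto
  have "void_collapsible (insert (T \<union> s) (insert (insert x (T \<union> s)) (K \<union> (\<lambda>g. T \<union> g) ` M)))"
  proof (rule void_collapsible.pair)
    show "void_collapsible (K \<union> (\<lambda>g. T \<union> g) ` M)" using pair by auto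
    show "x \<notin> T \<union> s" using pair.hyps(2) pair.prems[of "insert x s"] by auto
    fix t assume t: "t \<in> K \<union> (\<lambda>g. T \<union> g) ` M"
    show "\<not> T \<union> s \<subseteq> t"
    proof (cases "t \<in> K")
      case True
      then show ?thesis using assms(4) by auto
    next
      case False
      then obtain g where g: "g \<in> M" "t = T \<union> g" using t by auto
      then have "\<not> s \<subseteq> g" using pair.hyps(3) by auto
      moreover have "s \<inter> T = {}" using pair.prems by auto
      ultimately show ?thesis using g by auto
    qed
  qed
  then show ?case using sub by simp
qed

text \<open>The copies can be dismantled in any order, because no face of one copy contains the set
  \<open>T i\<close> of another.\<close>

lemma void_collapsible_UN_glue:
  assumes "finite I" "void_collapsible K"
    and "\<And>i. i \<in> I \<Longrightarrow> void_collapsible (M i)"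
    and "\<And>i g. i \<in> I \<Longrightarrow> g \<in> M i \<Longrightarrow> g \<inter> T i = {}"
    and "\<And>i t. i \<in> I \<Longrightarrow> t \<in> K \<Longrightarrow> \<not> T i \<subseteq> t"
    and "\<And>i j g. i \<in> I \<Longrightarrow> j \<in> I \<Longrightarrow> i \<noteq> j \<Longrightarrow> g \<in> M j \<Longrightarrow> \<not> T i \<subseteq> T j \<union> g"
  shows "void_collapsible (K \<union> (\<Union>i\<in>I. (\<lambda>g. T i \<union> g) ` M i))"
  using assms(1,3-6)
proof (induction I)
  case empty
  then show ?case using assms(2) by simp
next
  case (insert i I)
  have "void_collapsible ((K \<union> (\<Union>i\<in>I. (\<lambda>g. T i \<union> g) ` M i)) \<union> (\<lambda>g. T i \<union> g) ` M i)"
  proof (rule void_collapsible_glue)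
    show "void_collapsible (K \<union> (\<Union>i\<in>I. (\<lambda>g. T i \<union> g) ` M i))"
      by (rule insert.IH) (use insert.prems in \<open>simp_all\<close>)
    fix t assume "t \<in> K \<union> (\<Union>i\<in>I. (\<lambda>g. T i \<union> g) ` M i)"
    then consider "t \<in> K" | j g where "j \<in> I" "g \<in> M j" "t = T j \<union> g" by blast
    then show "\<not> T i \<subseteq> t"
    proof cases
      case 1
      then show ?thesis using insert.prems(3) by simp
    next
      case 2
      then show ?thesis using insert.prems(4)[of i j g] insert.hyps by auto
    qed
  qed (use insert.prems in auto)
  moreover have "(K \<union> (\<Union>i\<in>I. (\<lambda>g. T i \<union> g) ` M i)) \<union> (\<lambda>g. T i \<union> g) ` M i
     = K \<union> (\<Union>i\<in>insert i I. (\<lambda>g. T i \<union> g) ` M i)" by auto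
  ultimately show ?case by simp
qed

text \<open>Faces go in pairs \<open>m\<close>, \<open>insert v m\<close> with \<open>m\<close>
  maximal among the remaining faces without \<open>v\<close>, so that nothing else contains
  \<open>m\<close>.\<close>

lemma void_collapsible_cone:
  assumes "finite K" "\<And>s. s \<in> K \<Longrightarrow> v \<notin> s"
  shows "void_collapsible (K \<union> insert v ` K)"
  using assms
proof (induction K rule: finite_psubset_induct)
  case (psubset K)
  show ?case
  proof (cases "K = {}")
    case True
    then show ?thesis using void_collapsible.empty by simp
  next
    case False
    then obtain m where m: "m \<in> K" and mx: "\<And>t. t \<in> K \<Longrightarrow> m \<subseteq> t \<Longrightarrow> m = t"
      using finite_has_maximal[OF psubset.hyps] by metis
    have "void_collapsible ((K - {m}) \<union> insert v ` (K - {m}))"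
      using psubset m by auto
    then have "void_collapsible (insert m (insert (insert v m) ((K - {m}) \<union> insert v ` (K - {m}))))"
    proof (rule void_collapsible.pair)
      show "v \<notin> m" using m psubset.prems by auto
      fix t assume "t \<in> K - {m} \<union> insert v ` (K - {m})"
      then consider "t \<in> K - {m}" | u where "u \<in> K - {m}" "t = insert v u" by auto
      then show "\<not> m \<subseteq> t"
      proof cases
        case 1
        then show ?thesis using mx by auto
      next
        case 2
        then show ?thesis using mx[of u] m psubset.prems by auto
      qed
    qed
    moreover have "insert m (insert (insert v m) ((K - {m}) \<union> insert v ` (K - {m})))
      = K \<union> insert v ` K" using m by auto
    ultimately show ?thesis by simp
  qed
qed

section \<open>Properly-connected hypergraphs\<close>

locale pc_hypergraph =
  fixes V :: "'a set" and C :: "'a set set" and d :: nat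
  assumes hyp: "hypergraph V C" and uni: "uniform d C" and pc: "properly_connected d C"
begin

lemma finite_V: "finite V" and edge_subset: "E \<in> C \<Longrightarrow> E \<subseteq> V"
  and edges_incomparable: "E \<in> C \<Longrightarrow> F \<in> C \<Longrightarrow> E \<subseteq> F \<Longrightarrow> E = F"
  using hyp unfolding hypergraph_def by simp_all

lemma card_edge: "E \<in> C \<Longrightarrow> card E = d"
  using uni unfolding uniform_def by simp

lemma finite_edge: "E \<in> C \<Longrightarrow> finite E"
  using finite_subset[OF edge_subset finite_V] .

lemma two_le_d: "E \<in> C \<Longrightarrow> 2 \<le> d"
  using hyp uni unfolding hypergraph_def uniform_def by fastforce

lemma finite_C: "finite C"
  by (rule finite_subset[of _ "Pow V"]) (use edge_subset finite_V in auto)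

text \<open>A step of a chain drops one vertex, so it costs at most one vertex of the intersection
  with a fixed earlier edge. Hence no chain from \<open>F\<close> to \<open>G\<close> is shorter
  than \<open>d - card (F \<inter> G)\<close>.\<close>

lemma chain_card_inter:
  assumes ch: "proper_chain C F G Es xs" and "i \<le> j" "j \<le> length xs"
  shows "d \<le> card (Es ! i \<inter> Es ! j) + (j - i)"
  using assms(2,3)
proof (induction j rule: dec_induct)
  case base
  have "Es ! i \<in> C" using ch base unfolding proper_chain_def by (auto simp: subset_iff)
  then show ?case using card_edge by simp
next
  case (step j)
  have mem: "Es ! j \<in> C" "Es ! Suc j \<in> C" "Es ! i \<in> C"
    using ch step unfolding proper_chain_def by (auto simp: subset_iff)
  have "card (Es ! j \<inter> Es ! Suc j) = d - 1"
    using ch step.prems mem card_edge unfolding proper_chain_def by auto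
  moreover have "card (Es ! j) = card (Es ! j \<inter> Es ! Suc j) + card (Es ! j - Es ! Suc j)"
    using finite_edge[OF mem(1)] by (metis card_Int_Diff)
  ultimately have c1: "card (Es ! j - Es ! Suc j) \<le> 1" using card_edge[OF mem(1)] by auto
  have "Es ! i \<inter> Es ! j \<subseteq> (Es ! i \<inter> Es ! Suc j) \<union> (Es ! j - Es ! Suc j)" by auto
  then have "card (Es ! i \<inter> Es ! j) \<le> card ((Es ! i \<inter> Es ! Suc j) \<union> (Es ! j - Es ! Suc j))"
    using finite_edge mem by (intro card_mono) auto
  also have "\<dots> \<le> card (Es ! i \<inter> Es ! Suc j) + card (Es ! j - Es ! Suc j)"
    by (rule card_Un_le)
  finally show ?case using step.IH step.prems step.hyps c1 by auto
qed

text \<open>For an edge \<open>E\<close> of a shortest possible chain the previous bound on both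
  sides gives \<open>d + card (F \<inter> G) \<le> card (E \<inter> F) + card (E \<inter>
  G)\<close>. The right side equals \<open>card (E \<inter> (F \<union> G)) + card (E \<inter> (F
  \<inter> G))\<close>, whose terms are at most \<open>d\<close> and
  \<open>card (F \<inter> G)\<close>; so both are extremal.\<close>

lemma chain_between:
  assumes ch: "proper_chain C F G Es xs" and len: "length xs = d - card (F \<inter> G)"
    and i: "i \<le> length xs"
  shows "F \<inter> G \<subseteq> Es ! i" and "Es ! i \<subseteq> F \<union> G"
proof -
  let ?E = "Es ! i"
  have mem: "?E \<in> C" "F \<in> C" "G \<in> C"
    using ch i unfolding proper_chain_def by (auto simp: subset_iff)
  note fin = finite_edge[OF mem(1)] finite_edge[OF mem(2)] finite_edge[OF mem(3)]
  have "Es \<noteq> []" and l: "length Es = length xs + 1" using ch unfolding proper_chain_def by auto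
  then have F: "Es ! 0 = F" and G: "Es ! length xs = G"
    using ch unfolding proper_chain_def by (auto simp: hd_conv_nth last_conv_nth)
  have le: "card (F \<inter> G) \<le> d" using card_mono[OF fin(2), of "F \<inter> G"] card_edge mem by auto
  have "d \<le> card (F \<inter> ?E) + i" using chain_card_inter[OF ch, of 0 i] i F by simp
  moreover have "d \<le> card (?E \<inter> G) + (length xs - i)"
    using chain_card_inter[OF ch, of i "length xs"] i G by simp
  ultimately have A: "d + card (F \<inter> G) \<le> card (?E \<inter> F) + card (?E \<inter> G)"
    using len le i by (simp add: Int_commute)
  have "card (?E \<inter> F) + card (?E \<inter> G) = card (?E \<inter> F \<union> ?E \<inter> G) + card ((?E \<inter> F) \<inter> (?E \<inter> G))"
    using fin by (intro card_Un_Int) auto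
  also have "?E \<inter> F \<union> ?E \<inter> G = ?E \<inter> (F \<union> G)" by auto
  also have "(?E \<inter> F) \<inter> (?E \<inter> G) = ?E \<inter> (F \<inter> G)" by auto
  finally have B: "d + card (F \<inter> G) \<le> card (?E \<inter> (F \<union> G)) + card (?E \<inter> (F \<inter> G))" using A by simp
  have b1: "card (?E \<inter> (F \<union> G)) \<le> d" using card_mono[OF fin(1), of "?E \<inter> (F \<union> G)"] card_edge mem by auto
  have b2: "card (?E \<inter> (F \<inter> G)) \<le> card (F \<inter> G)" using fin by (intro card_mono) auto
  from B b1 b2 have c1: "card (?E \<inter> (F \<union> G)) = card ?E"
    and c2: "card (?E \<inter> (F \<inter> G)) = card (F \<inter> G)" using card_edge[OF mem(1)] by auto
  have "?E \<inter> (F \<union> G) = ?E" using card_subset_eq[OF fin(1) _ c1] by auto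
  then show "?E \<subseteq> F \<union> G" by auto
  have "?E \<inter> (F \<inter> G) = F \<inter> G" using card_subset_eq[OF _ _ c2] fin by auto
  then show "F \<inter> G \<subseteq> ?E" by auto
qed

lemma chain_edges:
  assumes "proper_chain C F G Es xs"
  shows "Es ! 0 = F" "Es ! length xs = G" "\<And>i. i \<le> length xs \<Longrightarrow> Es ! i \<in> C" "F \<in> C" "G \<in> C"
    "\<And>i. i < length xs \<Longrightarrow> card (Es ! i \<inter> Es ! (i + 1)) = d - 1"
proof -
  have "Es \<noteq> []" and l: "length Es = length xs + 1" using assms unfolding proper_chain_def by auto
  then show "Es ! 0 = F" "Es ! length xs = G"
    using assms unfolding proper_chain_def by (auto simp: hd_conv_nth last_conv_nth)
  show C: "Es ! i \<in> C" if "i \<le> length xs" for i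
    using assms that unfolding proper_chain_def by (auto simp: subset_iff)
  show "F \<in> C" "G \<in> C" using assms unfolding proper_chain_def by auto
  fix i assume i: "i < length xs"
  then show "card (Es ! i \<inter> Es ! (i + 1)) = d - 1"
    using assms card_edge[OF C[of "Suc i"]] unfolding proper_chain_def by auto
qed

lemma edge_nbhd_meetsI:
  assumes E: "E \<in> C" and F: "F \<in> C" and i: "card (E \<inter> F) = d - 1" and sub: "E \<subseteq> F \<union> G"
  shows "G \<inter> edge_nbhd C F \<noteq> {}"
proof -
  have "card E = card (E \<inter> F) + card (E - F)" using finite_edge[OF E] by (metis card_Int_Diff)
  then have 1: "card (E - F) = 1" using i card_edge[OF E] two_le_d[OF E] by auto
  then obtain b where b: "E - F = {b}" by (auto simp: card_1_singleton_iff)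
  then have "b \<in> edge_nbhd C F" unfolding edge_nbhd_def using E 1 by blast
  moreover have "b \<in> G" using b sub by auto
  ultimately show ?thesis by auto
qed

text \<open>The edge after \<open>F\<close> has one vertex outside \<open>F\<close> and lies in
  \<open>F \<union> G\<close>, so that vertex belongs to \<open>G\<close>; the other end is
  symmetric. Disjoint \<open>F\<close> and \<open>G\<close> are included, with chains of length
  \<open>d\<close>; \<open>far_edges\<close> relies on that case.\<close>

lemma chain_meets_nbhd:
  assumes ch: "proper_chain C F G Es xs" and len: "length xs = d - card (F \<inter> G)" and ne: "F \<noteq> G"
  shows "G \<inter> edge_nbhd C F \<noteq> {}" "F \<inter> edge_nbhd C G \<noteq> {}"
proof -
  note ce = chain_edges[OF ch]
  have l: "0 < length xs" using ce(1,2) ne by (metis gr0I)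
  let ?k = "length xs - 1"
  have b: "Es ! 1 \<subseteq> F \<union> G" "Es ! ?k \<subseteq> G \<union> F"
    using chain_between(2)[OF ch len, of 1] chain_between(2)[OF ch len, of ?k] l by auto
  have i: "card (Es ! 1 \<inter> F) = d - 1" "card (Es ! ?k \<inter> G) = d - 1"
    using ce(6)[of 0] ce(6)[of ?k] ce(1,2) l by (simp_all add: Int_commute)
  have m: "Es ! 1 \<in> C" "Es ! ?k \<in> C" using ce(3)[of 1] ce(3)[of ?k] l by simp_all
  show "G \<inter> edge_nbhd C F \<noteq> {}" by (rule edge_nbhd_meetsI[OF m(1) ce(4) i(1) b(1)])
  show "F \<inter> edge_nbhd C G \<noteq> {}" by (rule edge_nbhd_meetsI[OF m(2) ce(5) i(2) b(2)])
qed

text \<open>The prescribed distance is finite, so the infimum ranges over a nonempty set, and in the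
  well-order \<open>enat\<close> it is attained.\<close>

lemma obtain_geodesic:
  assumes "F \<in> C" "G \<in> C" "F \<inter> G \<noteq> {}"
  obtains Es xs where "irredundant_chain C F G Es xs" "length xs = d - card (F \<inter> G)"
proof -
  let ?N = "{length xs | Es xs. irredundant_chain C F G Es xs}"
  have "hdist C F G = enat (d - card (F \<inter> G))"
    using pc assms(3) bspec[OF bspec[OF conjunct2[OF pc[unfolded properly_connected_def]] assms(1)] assms(2)] by simp
  then have h: "Inf (enat ` ?N) = enat (d - card (F \<inter> G))" by (simp only: hdist_def)
  have "enat ` ?N \<noteq> {}"
  proof
    assume "enat ` ?N = {}"
    then have "Inf (enat ` ?N) = \<infinity>" unfolding Inf_enat_def by simp
    then show False using h by simp
  qed
  then obtain k where "k \<in> enat ` ?N" by blast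
  then have "Inf (enat ` ?N) \<in> enat ` ?N" by (rule wellorder_InfI)
  then have "d - card (F \<inter> G) \<in> ?N" unfolding h by (metis (no_types, lifting) imageE enat.inject)
  then show ?thesis using that by auto
qed

lemma meeting_edge_meets_nbhd:
  assumes "F \<in> C" "G \<in> C" "F \<inter> G \<noteq> {}" "F \<noteq> G"
  shows "G \<inter> edge_nbhd C F \<noteq> {}"
proof -
  obtain Es xs where "irredundant_chain C F G Es xs" "length xs = d - card (F \<inter> G)"
    using obtain_geodesic assms by metis
  then show ?thesis using chain_meets_nbhd(1) assms(4) unfolding irredundant_chain_def by blast
qed

text \<open>Disjointness forces length at least \<open>d\<close>, and length exactly
  \<open>d\<close> would make \<open>G\<close> meet the neighbourhood of \<open>F\<close>. Chains
  are directed, so both orders are recorded; the two conclusions of \<open>chain_meets_nbhd\<close>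
  cover them under the same asymmetric hypothesis.\<close>

lemma far_edges:
  assumes "F \<in> C" "G \<in> C" "F \<inter> G = {}" "G \<inter> edge_nbhd C F = {}"
  shows "enat (d + 1) \<le> hdist C F G" "enat (d + 1) \<le> hdist C G F"
proof -
  have ne: "F \<noteq> G" using assms(1,3) two_le_d[of F] card_edge[of F] by auto
  have *: "d + 1 \<le> length xs" if ch: "proper_chain C P Q Es xs" and PQ: "P = F \<and> Q = G \<or> P = G \<and> Q = F"
    for P Q Es xs
  proof (rule ccontr)
    assume n: "\<not> d + 1 \<le> length xs"
    have PQ0: "card (P \<inter> Q) = 0" using PQ assms(3) by (auto simp: Int_commute)
    have "d \<le> length xs"
      using chain_card_inter[OF ch, of 0 "length xs"] chain_edges(1,2)[OF ch] PQ0 by simp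
    then have "length xs = d - card (P \<inter> Q)" using n PQ0 by simp
    from chain_meets_nbhd[OF ch this] show False using PQ ne assms(4) by auto
  qed
  show "enat (d + 1) \<le> hdist C F G" "enat (d + 1) \<le> hdist C G F"
    unfolding hdist_def by (rule INF_greatest; use * in \<open>force simp: irredundant_chain_def\<close>)+
qed

text \<open>The singletons of neighbours of \<open>F\<close> are among the differences
  \<open>E - F\<close>, so a minimal difference with at least two elements avoids
  \<open>edge_nbhd C F\<close>. By proper connectedness its edge then misses \<open>F\<close>, and
  the difference is the edge itself.\<close>

lemma colon_edges_eq:
  assumes F: "F \<in> C"
  shows "colon_edges C F = induced C (colon_vertices V C F)"
proof -
  let ?M = "{E - F | E. E \<in> C \<and> E \<noteq> F}"
  let ?N = "edge_nbhd C F"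
  have nb: "{b} \<in> ?M" if b: "b \<in> ?N" for b
  proof -
    obtain E where E: "E \<in> C" "card (E - F) = 1" "b \<in> E - F" using b unfolding edge_nbhd_def by blast
    then have "E - F = {b}" by (metis card_1_singletonE singletonD)
    moreover have "E \<noteq> F" using E by auto
    ultimately show ?thesis using E by blast
  qed
  have disj: "E - F = E \<and> E \<inter> ?N = {}" if E: "E \<in> C" "E \<noteq> F" and min: "\<And>T. T \<in> ?M \<Longrightarrow> T \<subseteq> E - F \<Longrightarrow> T = E - F"
     and c: "2 \<le> card (E - F)" for E
  proof -
    have "E \<inter> ?N = {}"
    proof (rule ccontr)
      assume "E \<inter> ?N \<noteq> {}"
      then obtain b where b: "b \<in> E" "b \<in> ?N" by auto
      have "b \<notin> F" using b(2) unfolding edge_nbhd_def by auto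
      then have "{b} = E - F" using min[OF nb[OF b(2)]] b(1) by auto
      then show False using c by (metis card_1_singleton_iff One_nat_def Suc_1 not_less_eq_eq order_refl)
    qed
    moreover have "F \<inter> E = {}" using meeting_edge_meets_nbhd[OF F E(1)] E(2) calculation by auto
    ultimately show ?thesis by auto
  qed
  have "S \<in> colon_edges C F \<longleftrightarrow> S \<in> induced C (colon_vertices V C F)" for S
  proof
    assume "S \<in> colon_edges C F"
    then obtain E where E: "E \<in> C" "E \<noteq> F" "S = E - F" "2 \<le> card S" "\<And>T. T \<in> ?M \<Longrightarrow> T \<subseteq> S \<Longrightarrow> T = S"
      unfolding colon_edges_def Let_def by auto
    have "E - F = E \<and> E \<inter> ?N = {}"
    proof (rule disj[OF E(1,2)])
      show "2 \<le> card (E - F)" using E(3,4) by simp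
      show "T = E - F" if "T \<in> ?M" "T \<subseteq> E - F" for T using E(5)[OF that(1)] that(2) E(3) by simp
    qed
    then show "S \<in> induced C (colon_vertices V C F)"
      using E edge_subset[OF E(1)] unfolding induced_def colon_vertices_def by auto
  next
    assume S: "S \<in> induced C (colon_vertices V C F)"
    then have SC: "S \<in> C" and dj: "S \<inter> F = {}" "S \<inter> ?N = {}"
      unfolding induced_def colon_vertices_def by auto
    have c: "2 \<le> card S" using SC card_edge two_le_d by auto
    have neF: "S \<noteq> F" using dj(1) c by auto
    have SM: "S = S - F" using dj(1) by auto
    have "T = S" if T: "T \<in> ?M" "T \<subseteq> S" for T
    proof -
      obtain E where E: "E \<in> C" "E \<noteq> F" "T = E - F" using T(1) by auto
      have "E \<inter> ?N \<subseteq> T" using E unfolding edge_nbhd_def by auto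
      then have "E \<inter> ?N = {}" using T(2) dj(2) by auto
      then have "F \<inter> E = {}" using meeting_edge_meets_nbhd[OF F E(1)] E(2) by auto
      then have "T = E" using E(3) by auto
      then show ?thesis using edges_incomparable[OF E(1) SC] T(2) by auto
    qed
    then show "S \<in> colon_edges C F"
      unfolding colon_edges_def Let_def using SC neF SM c by blast
  qed
  then show ?thesis by blast
qed

lemma Ind_colon_edges:
  assumes "F \<in> C"
  shows "Ind (colon_vertices V C F) (colon_edges C F) = Ind (colon_vertices V C F) C"
  unfolding colon_edges_eq[OF assms] Ind_def induced_def by auto

section \<open>Simplicial vertices and families of removable facets\<close>

lemma simplicial_vertex_exchange:
  assumes v: "v \<in> A"
    and complete: "induced (induced C A) (vnbhd (induced C A) v) = {S. S \<subseteq> vnbhd (induced C A) v \<and> card S = d}"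
    and twice: "\<And>F G Es xs. irredundant_chain (induced C A) F G Es xs \<Longrightarrow> length (filter (\<lambda>E. v \<in> E) Es) \<le> 2"
    and E: "E \<in> C" "E \<subseteq> A" "v \<in> E" and G: "G \<in> C" "G \<subseteq> A" "v \<in> G" and ne: "E \<noteq> G"
  shows "(E \<union> G) - {v} \<in> C"
proof -
  have "E \<inter> G \<noteq> {}" using E G by auto
  then obtain Es xs where ir: "irredundant_chain C E G Es xs" and len: "length xs = d - card (E \<inter> G)"
    using obtain_geodesic E G by metis
  then have ch: "proper_chain C E G Es xs" unfolding irredundant_chain_def by auto
  have lE: "length Es = length xs + 1" using ch unfolding proper_chain_def by auto
  \<comment> \<open>The geodesic is taken in \<open>C\<close>, but it stays between
    \<open>E \<inter> G\<close> and \<open>E \<union> G\<close>; so it lives in \<open>A\<close> and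
    each of its edges contains \<open>v\<close>.\<close>
  have all: "v \<in> H \<and> H \<subseteq> A" if H: "H \<in> set Es" for H
  proof -
    obtain i where "i \<le> length xs" "H = Es ! i" using H lE by (metis in_set_conv_nth less_Suc_eq_le Suc_eq_plus1)
    then show ?thesis using chain_between[OF ch len, of i] E G by auto
  qed
  have pr: "proper_chain (induced C A) E G Es xs"
    using ch all E G unfolding proper_chain_def induced_def by auto
  have mono: "proper_chain C P Q Es' xs'" if "proper_chain (induced C A) P Q Es' xs'" for P Q Es' xs'
    using that unfolding proper_chain_def induced_def by auto
  \<comment> \<open>Passing to the induced hypergraph leaves fewer chains that could witness
    redundancy.\<close>
  have "irredundant_chain (induced C A) E G Es xs"
    using ir pr mono unfolding irredundant_chain_def by blast
  then have "length (filter (\<lambda>E. v \<in> E) Es) \<le> 2" using twice by blast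
  moreover have "filter (\<lambda>E. v \<in> E) Es = Es" using all by (auto simp: filter_id_conv)
  ultimately have "d - card (E \<inter> G) \<le> 1" using lE len by simp
  moreover have "card (E \<inter> G) < card E"
    using finite_edge[OF E(1)] edges_incomparable[OF E(1) G(1)] ne by (intro psubset_card_mono) auto
  ultimately have i: "card (E \<inter> G) = d - 1" using card_edge[OF E(1)] by auto
  have "card E + card G = card (E \<union> G) + card (E \<inter> G)"
    using finite_edge E G by (intro card_Un_Int) auto
  then have "card (E \<union> G) = d + 1" using card_edge[OF E(1)] card_edge[OF G(1)] i two_le_d[OF E(1)] by auto
  then have "card ((E \<union> G) - {v}) = d" using E by auto
  moreover have "(E \<union> G) - {v} \<subseteq> vnbhd (induced C A) v"
    unfolding vnbhd_def induced_def using E G by auto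
  ultimately have "(E \<union> G) - {v} \<in> induced (induced C A) (vnbhd (induced C A) v)"
    using complete by auto
  then show ?thesis unfolding induced_def by auto
qed

text \<open>The facets whose removal leaves a collapsible complex; they play the part of critical
  cells. The distance refers to \<open>C\<close> and not to \<open>induced C A\<close>, so that
  disjoint sets found for a smaller \<open>A\<close> can be reused unchanged.\<close>

definition critical :: "'a set \<Rightarrow> 'a set set \<Rightarrow> bool" where
  "critical A \<Phi> \<longleftrightarrow> void_collapsible (Ind A C - \<Phi>) \<and> \<Phi> \<subseteq> Ind A C
     \<and> (\<forall>f\<in>\<Phi>. \<forall>g\<in>Ind A C. f \<subseteq> g \<longrightarrow> g = f)
     \<and> (\<forall>f\<in>\<Phi>. \<exists>S\<subseteq>induced C A. pairwise_disjoint_dist C (d + 1) S \<and> card f = (d - 1) * card S)"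

lemma finite_Ind: "finite A \<Longrightarrow> finite (Ind A C)"
  unfolding Ind_def by (rule finite_subset[of _ "Pow A"]) auto

text \<open>The complex is a cone with apex \<open>v\<close>, so no facet has to be removed.\<close>

lemma critical_isolated:
  assumes "finite A" "v \<in> A" "\<And>E. E \<in> C \<Longrightarrow> E \<subseteq> A \<Longrightarrow> v \<notin> E"
  shows "critical A {}"
proof -
  let ?K = "{s \<in> Ind A C. v \<notin> s}"
  have a: "insert v s \<in> Ind A C" if "s \<in> Ind A C" "v \<notin> s" for s
  proof -
    have "s \<subseteq> A" "insert v s \<subseteq> A" using that assms(2) unfolding Ind_def by auto
    moreover have "\<not> E \<subseteq> insert v s" if E: "E \<in> C" for E
    proof
      assume sub: "E \<subseteq> insert v s"
      then have "v \<notin> E" using assms(3)[OF E] \<open>insert v s \<subseteq> A\<close> by (meson order_trans)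
      then have "E \<subseteq> s" using sub by auto
      then show False using \<open>s \<in> Ind A C\<close> E unfolding Ind_def by simp
    qed
    ultimately show ?thesis unfolding Ind_def by simp
  qed
  have b: "s \<in> insert v ` ?K" if "s \<in> Ind A C" "v \<in> s" for s
  proof -
    have "s - {v} \<in> ?K" using that unfolding Ind_def by auto
    moreover have "s = insert v (s - {v})" using that by auto
    ultimately show ?thesis by blast
  qed
  have "Ind A C = ?K \<union> insert v ` ?K" using a b by blast
  moreover have "void_collapsible (?K \<union> insert v ` ?K)"
    by (rule void_collapsible_cone) (use finite_Ind[OF assms(1)] in auto)
  ultimately show ?thesis unfolding critical_def by simp
qed

text \<open>The sets \<open>E - {v}\<close> are the obstructions to extending a face by
  \<open>v\<close>. If no edge inside \<open>A\<close> contains \<open>v\<close>, the union is empty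
  and only the cone remains.\<close>

lemma critical_step:
  assumes A: "finite A" "v \<in> A"
    and complete: "induced (induced C A) (vnbhd (induced C A) v) = {S. S \<subseteq> vnbhd (induced C A) v \<and> card S = d}"
    and twice: "\<And>F G Es xs. irredundant_chain (induced C A) F G Es xs \<Longrightarrow> length (filter (\<lambda>E. v \<in> E) Es) \<le> 2"
    and \<Psi>: "\<And>E. E \<in> C \<Longrightarrow> E \<subseteq> A \<Longrightarrow> v \<in> E \<Longrightarrow> critical (A - (E \<union> edge_nbhd C E)) (\<Psi> E)"
  shows "critical A (\<Union>E\<in>{E \<in> C. E \<subseteq> A \<and> v \<in> E}. (\<lambda>g. (E - {v}) \<union> g) ` \<Psi> E)" (is "critical A ?\<Phi>")
proof -
  let ?J = "{E \<in> C. E \<subseteq> A \<and> v \<in> E}"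
  define B where "B E = A - (E \<union> edge_nbhd C E)" for E
  define T where "T E = E - {v}" for E :: "'a set"
  let ?X = "Ind A C"
  have exch: "(E \<union> G) - {v} \<in> C" if "E \<in> ?J" "G \<in> ?J" "E \<noteq> G" for E G
    by (rule simplicial_vertex_exchange[OF A(2) complete]) (fact twice, use that in auto)
  \<comment> \<open>A face above two of the obstructions would contain the edge supplied by the
    exchange.\<close>
  have uniq: "E = G" if "E \<in> ?J" "G \<in> ?J" "T E \<subseteq> s" "T G \<subseteq> s" "s \<in> ?X" for E G s
  proof (rule ccontr)
    assume "E \<noteq> G"
    then have "(E \<union> G) - {v} \<in> C" using exch that by blast
    moreover have "(E \<union> G) - {v} \<subseteq> s" using that unfolding T_def by auto
    ultimately show False using that(5) unfolding Ind_def by auto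
  qed
  \<comment> \<open>From left to right, suppose \<open>b\<close> in \<open>g\<close> and
    \<open>E' - E = {b}\<close>: then \<open>E'\<close> or, if \<open>v \<in> E'\<close>, the
    exchanged edge lies in \<open>T E \<union> g\<close>. From right to left, an edge inside
    \<open>T E \<union> g\<close> avoids \<open>v\<close>, so it differs from \<open>E\<close>; it
    lies in \<open>g\<close> or meets \<open>edge_nbhd C E\<close>, and both are excluded.\<close>
  have link: "T E \<union> g \<in> ?X \<longleftrightarrow> g \<in> Ind (B E) C" if E: "E \<in> ?J" and g: "g \<inter> T E = {}" for E g
  proof
    assume X: "T E \<union> g \<in> ?X"
    have "v \<notin> g" using X E unfolding Ind_def T_def by auto
    have "b \<notin> g" if b: "b \<in> edge_nbhd C E" for b
    proof
      assume bg: "b \<in> g"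
      obtain E' where E': "E' \<in> C" "card (E' - E) = 1" "b \<in> E' - E" using b unfolding edge_nbhd_def by blast
      then have eq: "E' - E = {b}" by (metis card_1_singletonE singletonD)
      have bA: "b \<in> A" using X bg unfolding Ind_def by auto
      have sub: "E' \<subseteq> insert b E" using eq by blast
      have 1: "(E \<union> E') - {v} \<subseteq> T E \<union> g" using sub bg unfolding T_def by blast
      have 2: "E' \<subseteq> T E \<union> g" if "v \<notin> E'" using sub bg that unfolding T_def by blast
      have 3: "(E \<union> E') - {v} \<in> C" if "v \<in> E'"
      proof (rule exch)
        show "E' \<in> ?J" using that E'(1) E sub bA by auto
        show "E \<noteq> E'" using E'(3) by blast
      qed (rule E)
      show False
      proof (cases "v \<in> E'")
        case True
        then show False using X 3 1 unfolding Ind_def by auto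
      next
        case False
        then show False using X E'(1) 2 unfolding Ind_def by auto
      qed
    qed
    moreover have "g \<inter> E = {}" using g \<open>v \<notin> g\<close> unfolding T_def by auto
    moreover have "g \<subseteq> A" "\<And>H. H \<in> C \<Longrightarrow> \<not> H \<subseteq> g" using X unfolding Ind_def by auto
    ultimately show "g \<in> Ind (B E) C" unfolding Ind_def B_def by auto
  next
    assume G: "g \<in> Ind (B E) C"
    have "\<not> H \<subseteq> T E \<union> g" if H: "H \<in> C" for H
    proof
      assume s: "H \<subseteq> T E \<union> g"
      show False
      proof (cases "E \<inter> H = {}")
        case True
        then have "H \<subseteq> g" using s unfolding T_def by auto
        then show False using G H unfolding Ind_def by auto
      next
        case False
        have "v \<notin> H" using s G E unfolding Ind_def T_def B_def by auto
        then have "H \<inter> edge_nbhd C E \<noteq> {}" using meeting_edge_meets_nbhd[OF _ H False] E by auto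
        moreover have "edge_nbhd C E \<inter> E = {}" unfolding edge_nbhd_def by auto
        moreover have "g \<inter> edge_nbhd C E = {}" using G unfolding Ind_def B_def by auto
        moreover have "T E \<subseteq> E" unfolding T_def by auto
        ultimately show False using s by blast
      qed
    qed
    then show "T E \<union> g \<in> ?X" using G E unfolding Ind_def T_def B_def by auto
  qed
  have disj: "g \<inter> T E = {}" "g \<inter> E = {}" if "g \<in> Ind (B E) C" for E g
    using that unfolding Ind_def B_def T_def by auto
  have cr: "critical (B E) (\<Psi> E)" if "E \<in> ?J" for E using \<Psi> that unfolding B_def by auto
  have \<Psi>I: "\<Psi> E \<subseteq> Ind (B E) C" if "E \<in> ?J" for E using cr[OF that] unfolding critical_def by auto
  \<comment> \<open>The base of the cone: faces without \<open>v\<close> that contain no obstruction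
    and therefore extend by \<open>v\<close>.\<close>
  let ?K = "{s \<in> ?X. v \<notin> s \<and> (\<forall>E\<in>?J. \<not> T E \<subseteq> s)}"
  have in_link: "s - T E \<in> Ind (B E) C" if "s \<in> ?X" "E \<in> ?J" "T E \<subseteq> s" for s E
  proof -
    have "T E \<union> (s - T E) = s" using that by auto
    then show ?thesis using link[OF that(2), of "s - T E"] that(1) by auto
  qed
  have Phi: "?\<Phi> = (\<Union>E\<in>?J. (\<lambda>g. T E \<union> g) ` \<Psi> E)" unfolding T_def by auto
  have kv: "insert v s \<in> ?X" if "s \<in> ?K" for s
  proof -
    have *: "E \<subseteq> s" if E: "E \<in> C" "E \<subseteq> insert v s" for E
    proof (cases "v \<in> E")
      case True
      then have "E \<in> ?J" using E \<open>s \<in> ?K\<close> A(2) unfolding Ind_def by auto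
      then show ?thesis using \<open>s \<in> ?K\<close> E unfolding T_def by auto
    qed (use E in auto)
    have "\<not> E \<subseteq> insert v s" if "E \<in> C" for E
      using *[OF that] \<open>s \<in> ?K\<close> that unfolding Ind_def by auto
    then show ?thesis using that A(2) unfolding Ind_def by simp
  qed
  have vk: "s - {v} \<in> ?K" if "s \<in> ?X" "v \<in> s" for s
  proof -
    have "\<not> T E \<subseteq> s - {v}" if "E \<in> ?J" for E
    proof
      assume "T E \<subseteq> s - {v}"
      then have "E \<subseteq> s" using \<open>v \<in> s\<close> unfolding T_def by auto
      then show False using \<open>s \<in> ?X\<close> that unfolding Ind_def by auto
    qed
    then show ?thesis using that unfolding Ind_def by auto
  qed
  have split: "?X - ?\<Phi> = (?K \<union> insert v ` ?K) \<union> (\<Union>E\<in>?J. (\<lambda>g. T E \<union> g) ` (Ind (B E) C - \<Psi> E))" (is "?L = ?R")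
  proof
    show "?L \<subseteq> ?R"
    proof
      fix s assume s: "s \<in> ?L"
      then have sX: "s \<in> ?X" by simp
      then consider "v \<in> s" | "s \<in> ?K" | E where "E \<in> ?J" "T E \<subseteq> s" by blast
      then show "s \<in> ?R"
      proof cases
        case 1
        then have "s = insert v (s - {v})" "s - {v} \<in> ?K" using vk s by auto
        then show ?thesis by blast
      next
        case 3
        define g where "g = s - T E"
        have g: "s = T E \<union> g" "g \<in> Ind (B E) C" using 3 in_link sX unfolding g_def by auto
        have "s \<in> ?\<Phi>" if "g \<in> \<Psi> E"
          unfolding Phi using g(1) that by (intro UN_I[OF 3(1)] image_eqI)
        then have "g \<in> Ind (B E) C - \<Psi> E" using s g(2) by auto
        then show ?thesis using g(1) by (intro UnI2 UN_I[OF 3(1)] image_eqI)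
      qed auto
    qed
    show "?R \<subseteq> ?L"
    proof
      fix s assume "s \<in> ?R"
      then consider "s \<in> ?K" | t where "s = insert v t" "t \<in> ?K" | E g where "E \<in> ?J" "g \<in> Ind (B E) C" "g \<notin> \<Psi> E" "s = T E \<union> g"
        by blast
      then show "s \<in> ?L"
      proof cases
        case 1
        then show ?thesis using Phi by auto
      next
        case 2
        have "v \<notin> T E \<union> g" if "E \<in> ?J" "g \<in> \<Psi> E" for E g
          using disj(2) \<Psi>I[OF that(1)] that unfolding T_def by auto
        then have "s \<notin> ?\<Phi>" unfolding Phi 2(1) by auto
        then show ?thesis using kv 2 by auto
      next
        case 3
        have sX: "s \<in> ?X" using link[OF 3(1) disj(1)[OF 3(2)]] 3 by auto
        have "s \<notin> ?\<Phi>"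
        proof
          assume "s \<in> ?\<Phi>"
          then obtain E' g' where E': "E' \<in> ?J" "g' \<in> \<Psi> E'" "s = T E' \<union> g'" unfolding Phi by blast
          have "E' = E" by (rule uniq[of _ _ s]) (use E' 3 sX in auto)
          moreover have "g' \<inter> T E' = {}" using disj(1) \<Psi>I[OF E'(1)] E'(2) by auto
          ultimately have "g' = g" using disj(1)[OF 3(2)] E'(3) 3(4) by auto
          then show False using E' 3 \<open>E' = E\<close> by auto
        qed
        then show ?thesis using sX by auto
      qed
    qed
  qed
  have "void_collapsible ((?K \<union> insert v ` ?K) \<union> (\<Union>E\<in>?J. (\<lambda>g. T E \<union> g) ` (Ind (B E) C - \<Psi> E)))"
  proof (rule void_collapsible_UN_glue)
    show "finite ?J" using finite_C by auto
    show "void_collapsible (?K \<union> insert v ` ?K)"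
      by (rule void_collapsible_cone) (use finite_Ind[OF A(1)] in auto)
    fix E assume E: "E \<in> ?J"
    show "void_collapsible (Ind (B E) C - \<Psi> E)" using cr[OF E] unfolding critical_def by auto
    show "g \<inter> T E = {}" if "g \<in> Ind (B E) C - \<Psi> E" for g using disj that by auto
    show "\<not> T E \<subseteq> t" if "t \<in> ?K \<union> insert v ` ?K" for t
    proof
      assume *: "T E \<subseteq> t"
      have "v \<notin> T E" unfolding T_def by auto
      then show False using that * E by blast
    qed
    fix G g assume G: "G \<in> ?J" "E \<noteq> G" "g \<in> Ind (B G) C - \<Psi> G"
    have "T G \<union> g \<in> ?X" using link[OF G(1)] disj G by auto
    then show "\<not> T E \<subseteq> T G \<union> g" using uniq[OF E G(1), of "T G \<union> g"] G(2) by auto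
  qed
  then have 1: "void_collapsible (?X - ?\<Phi>)" using split by simp
  have 2: "?\<Phi> \<subseteq> ?X"
  proof
    fix f assume "f \<in> ?\<Phi>"
    then obtain E g where E: "E \<in> ?J" "g \<in> \<Psi> E" "f = T E \<union> g" unfolding Phi by blast
    then show "f \<in> ?X" using link[OF E(1)] disj(1) \<Psi>I[OF E(1)] by auto
  qed
  have 3: "h = f" if f: "f \<in> ?\<Phi>" and "h \<in> ?X" "f \<subseteq> h" for f h
  proof -
    obtain E g where E: "E \<in> ?J" "g \<in> \<Psi> E" "f = T E \<union> g" using f unfolding Phi by blast
    have "h - T E \<in> Ind (B E) C" using in_link[OF that(2) E(1)] E(3) that(3) by auto
    moreover have "g \<subseteq> h - T E" using E that disj(1)[of g E] \<Psi>I[OF E(1)] by auto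
    ultimately have "h - T E = g" using cr[OF E(1)] E(2) unfolding critical_def by auto
    then show ?thesis using E that by auto
  qed
  have 4: "\<exists>S\<subseteq>induced C A. pairwise_disjoint_dist C (d + 1) S \<and> card f = (d - 1) * card S" if f: "f \<in> ?\<Phi>" for f
  proof -
    obtain E g where E: "E \<in> ?J" "g \<in> \<Psi> E" "f = T E \<union> g" using f unfolding Phi by blast
    obtain S where S: "S \<subseteq> induced C (B E)" "pairwise_disjoint_dist C (d + 1) S" "card g = (d - 1) * card S"
      using cr[OF E(1)] E(2) unfolding critical_def by blast
    have gI: "g \<in> Ind (B E) C" using \<Psi>I E by auto
    have "finite g" using gI A(1) unfolding Ind_def B_def by (auto intro: finite_subset)
    have EC: "E \<in> C" using E by auto
    have "card f = card (T E) + card g"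
      unfolding E(3) by (rule card_Un_disjoint) (use \<open>finite g\<close> finite_edge[OF EC] disj(1)[OF gI] in \<open>auto simp: T_def\<close>)
    moreover have "card (T E) = d - 1" unfolding T_def using E card_edge[OF EC] by auto
    moreover have "finite S" using S(1) finite_C by (auto simp: induced_def intro: finite_subset)
    \<comment> \<open>Edges inside \<open>B E\<close> avoid \<open>E\<close> and its neighbourhood,
      so \<open>far_edges\<close> keeps \<open>insert E S\<close> admissible, while the face gains
      exactly the \<open>d - 1\<close> vertices of \<open>T E\<close>.\<close>
    moreover have far: "G \<in> C" "E \<inter> G = {}" "G \<inter> edge_nbhd C E = {}" if "G \<in> S" for G
      using S(1) that unfolding induced_def B_def by auto
    have "E \<notin> S" using far(2)[of E] two_le_d[OF EC] card_edge[OF EC] by auto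
    ultimately have "card f = (d - 1) * card (insert E S)" using S(3) by simp
    moreover have "pairwise_disjoint_dist C (d + 1) (insert E S)"
      using S(2) far_edges[OF EC] far unfolding pairwise_disjoint_dist_def by auto
    moreover have "insert E S \<subseteq> induced C A" using S(1) E unfolding induced_def B_def by auto
    ultimately show ?thesis by blast
  qed
  show ?thesis unfolding critical_def
  proof (intro conjI ballI impI)
    show "void_collapsible (?X - ?\<Phi>)" by (rule 1)
    show "?\<Phi> \<subseteq> ?X" by (rule 2)
  qed (use 3 4 in \<open>simp_all only:\<close>)
qed

context
  assumes tri: "triangulated V d C"
begin

text \<open>This distils from the triangulation property the only consequence used below.
  Quantifying over \<open>\<Psi>\<close> leaves the choice of the smaller families to the
  caller.\<close>

lemma obtain_simplicial_vertex:
  assumes "A \<subseteq> V" "A \<noteq> {}"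
  obtains v where "v \<in> A"
    "\<forall>\<Psi>. (\<forall>E. v \<in> E \<longrightarrow> critical (A - (E \<union> edge_nbhd C E)) (\<Psi> E))
      \<longrightarrow> critical A (\<Union>E\<in>{E \<in> C. E \<subseteq> A \<and> v \<in> E}. (\<lambda>g. (E - {v}) \<union> g) ` \<Psi> E)"
proof -
  obtain v where v: "v \<in> A"
    "induced (induced C A) (vnbhd (induced C A) v) = {S. S \<subseteq> vnbhd (induced C A) v \<and> card S = d}"
    "\<forall>F G Es xs. irredundant_chain (induced C A) F G Es xs \<longrightarrow> length (filter (\<lambda>E. v \<in> E) Es) \<le> 2"
    using tri assms unfolding triangulated_def by meson
  have fin: "finite A" using assms finite_V finite_subset by metis
  show ?thesis
  proof (rule that[OF v(1)], intro allI impI)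
    fix \<Psi> assume "\<forall>E. v \<in> E \<longrightarrow> critical (A - (E \<union> edge_nbhd C E)) (\<Psi> E)"
    then show "critical A (\<Union>E\<in>{E \<in> C. E \<subseteq> A \<and> v \<in> E}. (\<lambda>g. (E - {v}) \<union> g) ` \<Psi> E)"
      using v(3) by (intro critical_step[OF fin v(1,2)]) blast+
  qed
qed

lemma ex_critical: "A \<subseteq> V \<Longrightarrow> \<exists>\<Phi>. critical A \<Phi>"
proof (induction "card A" arbitrary: A rule: less_induct)
  case less
  show ?case
  proof (cases "A = {}")
    case True
    \<comment> \<open>The complex \<open>{{}}\<close> has no removable pair, so the empty face is
      itself the removed facet; its size 0 matches the empty set of edges.\<close>
    have "Ind A C = {{}}" using True two_le_d card_edge unfolding Ind_def by fastforce
    moreover have "\<exists>S\<subseteq>induced C A. pairwise_disjoint_dist C (d + 1) S \<and> card ({} :: 'a set) = (d - 1) * card S"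
      by (rule exI[of _ "{}"]) (simp add: pairwise_disjoint_dist_def)
    ultimately have "critical A {{}}" using void_collapsible.empty by (simp add: critical_def)
    then show ?thesis by blast
  next
    case False
    then obtain v where v: "v \<in> A"
      "\<forall>\<Psi>. (\<forall>E. v \<in> E \<longrightarrow> critical (A - (E \<union> edge_nbhd C E)) (\<Psi> E))
        \<longrightarrow> critical A (\<Union>E\<in>{E \<in> C. E \<subseteq> A \<and> v \<in> E}. (\<lambda>g. (E - {v}) \<union> g) ` \<Psi> E)"
      by (rule obtain_simplicial_vertex[OF less.prems])
    have "\<exists>\<Psi>. critical (A - (E \<union> edge_nbhd C E)) \<Psi>" if "v \<in> E" for E
    proof (rule less.hyps)
      show "card (A - (E \<union> edge_nbhd C E)) < card A"
      proof (rule psubset_card_mono)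
        show "finite A" using less.prems finite_V finite_subset by metis
        show "A - (E \<union> edge_nbhd C E) \<subset> A" using v(1) that by auto
      qed
    qed (use less.prems in auto)
    then have "\<exists>\<Psi>. \<forall>E. v \<in> E \<longrightarrow> critical (A - (E \<union> edge_nbhd C E)) (\<Psi> E)"
      by (intro choice) blast
    then show ?thesis using v(2) by metis
  qed
qed

text \<open>Any edge \<open>F\<close> through the simplicial vertex of \<open>V\<close> works,
  because \<open>\<Phi>\<close> is built from the families of such edges. If no edge contains that
  vertex, it survives in \<open>colon_vertices V C F0\<close> for every edge \<open>F0\<close>; both
  complexes are cones and both families are empty.\<close>

lemma ex_critical_colon:
  assumes "C \<noteq> {}"
  obtains F \<Phi> \<Psi> where "F \<in> C" "critical V \<Phi>" "critical (colon_vertices V C F) \<Psi>"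
    "\<And>g. g \<in> \<Psi> \<Longrightarrow> \<exists>f\<in>\<Phi>. card f = card g + (d - 1)"
proof -
  obtain F0 where F0: "F0 \<in> C" using assms by auto
  have "V \<noteq> {}" using edge_subset[OF F0] two_le_d[OF F0] card_edge[OF F0] by auto
  then obtain v where v: "v \<in> V"
      "\<forall>\<Psi>. (\<forall>E. v \<in> E \<longrightarrow> critical (V - (E \<union> edge_nbhd C E)) (\<Psi> E))
        \<longrightarrow> critical V (\<Union>E\<in>{E \<in> C. E \<subseteq> V \<and> v \<in> E}. (\<lambda>g. (E - {v}) \<union> g) ` \<Psi> E)"
    by (rule obtain_simplicial_vertex[OF order_refl])
  show ?thesis
  proof (cases "\<exists>F\<in>C. v \<in> F")
    case False
    then have "v \<in> colon_vertices V C F0"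
      using v(1) F0 unfolding colon_vertices_def edge_nbhd_def by auto
    moreover have "finite (colon_vertices V C F0)" using finite_V unfolding colon_vertices_def by auto
    ultimately have "critical (colon_vertices V C F0) {}" using critical_isolated False by blast
    moreover have "critical V {}" using critical_isolated[OF finite_V v(1)] False by blast
    ultimately show ?thesis using that[OF F0] by blast
  next
    case True
    then obtain F where F: "F \<in> C" "v \<in> F" by auto
    have "\<exists>\<Psi>. critical (V - (E \<union> edge_nbhd C E)) \<Psi>" for E using ex_critical[of "V - (E \<union> edge_nbhd C E)"] by auto
    then obtain \<Psi> where \<Psi>: "\<And>E. critical (V - (E \<union> edge_nbhd C E)) (\<Psi> E)" by metis
    let ?\<Phi> = "\<Union>E\<in>{E \<in> C. E \<subseteq> V \<and> v \<in> E}. (\<lambda>g. (E - {v}) \<union> g) ` \<Psi> E"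
    have c: "critical V ?\<Phi>" using v(2)[rule_format, of \<Psi>] \<Psi> by simp
    have "\<exists>f\<in>?\<Phi>. card f = card g + (d - 1)" if g: "g \<in> \<Psi> F" for g
    proof (rule bexI[of _ "(F - {v}) \<union> g"])
      have "g \<subseteq> V - (F \<union> edge_nbhd C F)" using \<Psi>[of F] g unfolding critical_def Ind_def by auto
      moreover from this have "finite g" using finite_V finite_subset by blast
      ultimately have "card ((F - {v}) \<union> g) = card (F - {v}) + card g"
        using finite_edge[OF F(1)] by (intro card_Un_disjoint) auto
      then show "card ((F - {v}) \<union> g) = card g + (d - 1)" using F card_edge by auto
      show "(F - {v}) \<union> g \<in> ?\<Phi>" using F g edge_subset by blast
    qed
    then show ?thesis using that[OF F(1) c, of "\<Psi> F"] \<Psi>[of F] unfolding colon_vertices_def by blast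
  qed
qed

end

lemma card_le_max_disjoint:
  assumes "S \<subseteq> C" "pairwise_disjoint_dist C (d + 1) S"
  shows "card S \<le> max_disjoint d C"
proof -
  have "finite {card S | S. S \<subseteq> C \<and> pairwise_disjoint_dist C (d + 1) S}"
    by (rule finite_subset[of _ "card ` Pow C"]) (use finite_C in auto)
  then show ?thesis unfolding max_disjoint_def by (intro Max_ge) (use assms in auto)
qed

end


section \<open>Geometric realizations\<close>

lemma topspace_realization:
  "topspace (realization V K) =
     {x \<in> extensional V. (\<forall>v\<in>V. 0 \<le> x v) \<and> sum x V = 1 \<and> {v \<in> V. x v \<noteq> 0} \<in> K}"
  by (auto simp: realization_def PiE_def)

lemma continuous_map_into_realization:
  "continuous_map X (realization V K) f \<longleftrightarrow>
     f \<in> topspace X \<rightarrow> topspace (realization V K) \<and> (\<forall>v\<in>V. continuous_map X euclideanreal (\<lambda>x. f x v))"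
  (is "?L = ?R")
proof
  assume ?L
  then show ?R
    unfolding topspace_realization unfolding realization_def
    by (auto simp: continuous_map_in_subtopology continuous_map_componentwise)
next
  assume R: ?R
  then have "f ` topspace X \<subseteq> extensional V"
    unfolding topspace_realization by auto
  then show ?L
    using R unfolding topspace_realization unfolding realization_def
    by (auto simp: continuous_map_in_subtopology continuous_map_componentwise)
qed

lemma continuous_map_realization_coordinate:
  "v \<in> V \<Longrightarrow> continuous_map (realization V K) euclideanreal (\<lambda>x. x v)"
  unfolding realization_def
  by (intro continuous_map_from_subtopology continuous_map_product_projection)

lemma homotopic_withI:
  assumes "continuous_map (prod_topology (top_of_set {0..1::real}) X) Y h"
    and "\<And>x. x \<in> topspace X \<Longrightarrow> h (0, x) = f x" "\<And>x. x \<in> topspace X \<Longrightarrow> h (1, x) = g x"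
  shows "homotopic_with (\<lambda>x. True) X Y f g"
  by (subst homotopic_with) (use assms in auto)

lemma continuous_map_Min:
  assumes "finite I" "I \<noteq> {}" "\<And>i. i \<in> I \<Longrightarrow> continuous_map X euclideanreal (f i)"
  shows "continuous_map X euclideanreal (\<lambda>x. Min ((\<lambda>i. f i x) ` I))"
  using assms
proof (induction I rule: finite_ne_induct)
  case (singleton i)
  then show ?case by simp
next
  case (insert i I)
  have "continuous_map X euclideanreal (\<lambda>x. min (f i x) (Min ((\<lambda>i. f i x) ` I)))"
    using insert by (intro continuous_map_real_min) auto
  then show ?case using insert.hyps by simp
qed

text \<open>The closed simplices are compact slices of boxes, and there are finitely many. Closure
  under subsets is what puts the boundary points of each of them into the realization.\<close>

lemma compact_space_realization:
  assumes V: "finite V" and K: "K \<subseteq> Pow V" and down: "\<And>s t. t \<in> K \<Longrightarrow> s \<subseteq> t \<Longrightarrow> s \<in> K"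
  shows "compact_space (realization V K)"
proof -
  let ?P = "product_topology (\<lambda>_. euclideanreal) V"
  define S where "S t = (PiE V (\<lambda>v. if v \<in> t then {0..1} else {0::real})) \<inter> {x \<in> topspace ?P. sum x V \<in> {1}}" for t
  have "compactin ?P (S t)" for t
  proof -
    have "compactin ?P (PiE V (\<lambda>v. if v \<in> t then {0..1} else {0::real}))"
      by (auto simp: compactin_PiE)
    moreover have "continuous_map ?P euclideanreal (\<lambda>x. sum x V)"
      by (intro continuous_map_sum V continuous_map_product_projection)
    then have "closedin ?P {x \<in> topspace ?P. sum x V \<in> {1}}"
      by (rule closedin_continuous_map_preimage) auto
    ultimately show ?thesis unfolding S_def by (rule compact_Int_closedin)
  qed
  then have "compactin ?P (\<Union>t\<in>K. S t)"
    using finite_subset[OF K] V by (intro compactin_Union) auto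
  moreover have "(\<Union>t\<in>K. S t) = topspace (realization V K)"
  proof
    show "(\<Union>t\<in>K. S t) \<subseteq> topspace (realization V K)"
    proof
      fix x assume "x \<in> (\<Union>t\<in>K. S t)"
      then obtain t where t: "t \<in> K" "x \<in> S t" by auto
      have "{v \<in> V. x v \<noteq> 0} \<subseteq> t" using t(2) unfolding S_def by (force simp: PiE_def Pi_def split: if_splits)
      then have "{v \<in> V. x v \<noteq> 0} \<in> K" using down t(1) by blast
      moreover have "0 \<le> x v" if "v \<in> V" for v
        using t(2) that unfolding S_def by (force simp: PiE_def Pi_def split: if_splits)
      ultimately show "x \<in> topspace (realization V K)"
        using t(2) unfolding S_def topspace_realization by (auto simp: PiE_def)
    qed
    show "topspace (realization V K) \<subseteq> (\<Union>t\<in>K. S t)"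
    proof
      fix x assume x: "x \<in> topspace (realization V K)"
      let ?t = "{v \<in> V. x v \<noteq> 0}"
      have "x v \<le> 1" if "v \<in> V" for v
        using x that member_le_sum[of v V x] V unfolding topspace_realization by auto
      then have "x \<in> S ?t" using x unfolding S_def topspace_realization by (auto simp: PiE_def)
      then show "x \<in> (\<Union>t\<in>K. S t)" using x unfolding topspace_realization by blast
    qed
  qed
  ultimately have "compactin ?P (topspace (realization V K))" by simp
  moreover have "realization V K = subtopology ?P (topspace (realization V K))"
    unfolding topspace_realization by (simp only: realization_def)
  ultimately show ?thesis by (metis compact_space_subtopology)
qed

section \<open>Elementary collapses and contractibility\<close>

lemma Min_image_facts:
  fixes p :: "'a \<Rightarrow> real"
  assumes "finite s" "s \<noteq> {}"
  shows "\<And>v. v \<in> s \<Longrightarrow> Min (p ` s) \<le> p v" "\<exists>v\<in>s. p v = Min (p ` s)"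
proof -
  show "\<And>v. v \<in> s \<Longrightarrow> Min (p ` s) \<le> p v" using assms by simp
  have "Min (p ` s) \<in> p ` s" using assms by (intro Min_in) auto
  then show "\<exists>v\<in>s. p v = Min (p ` s)" by force
qed

text \<open>The least coordinate over \<open>s\<close> is nonzero only in the two open simplices
  that are removed. Taking it away from every vertex of \<open>s\<close> and giving the total to
  \<open>x\<close> moves their points linearly into the rest and fixes everything else.\<close>

lemma elementary_collapse_homotopy_equivalent:
  assumes V: "finite V" and KV: "K \<subseteq> Pow V" and down: "\<And>s t. t \<in> K \<Longrightarrow> s \<subseteq> t \<Longrightarrow> s \<in> K"
    and K: "K = insert s (insert (insert x s) L)" and s: "s \<noteq> {}" "x \<notin> s"
    and L: "\<And>t. t \<in> L \<Longrightarrow> \<not> s \<subseteq> t"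
  shows "realization V K homotopy_equivalent_space realization V L"
proof -
  define k where "k p = Min (p ` s)" for p :: "'a \<Rightarrow> real"
  \<comment> \<open>The vertex \<open>x\<close> receives \<open>card s\<close> times the amount that
    each vertex of \<open>s\<close> loses, so the coordinate sum stays 1.\<close>
  define h where "h = (\<lambda>(t::real, p). restrict (\<lambda>v. p v + t * (k p * (if v = x then real (card s) else 0)
       - k p * (if v \<in> s then 1 else 0))) V)"
  have sV: "insert x s \<subseteq> V" using K KV by auto
  then have fs: "finite s" using V finite_subset by auto
  have kle: "k p \<le> p v" if "v \<in> s" for p v using Min_image_facts(1)[OF fs s(1) that] unfolding k_def .
  have kat: "\<exists>v\<in>s. p v = k p" for p using Min_image_facts(2)[OF fs s(1)] unfolding k_def by auto
  let ?X = "realization V K" and ?Y = "realization V L"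
  let ?supp = "\<lambda>p. {v \<in> V. p v \<noteq> (0::real)}"
  have k0: "0 \<le> k p" if "p \<in> topspace ?X" for p
    using kat[of p] that sV unfolding topspace_realization by force
  have kpos: "?supp p \<in> {s, insert x s}" if "p \<in> topspace ?X" "k p \<noteq> 0" for p
  proof -
    have "p v \<noteq> 0" if "v \<in> s" for v using kle[OF that, of p] k0[OF \<open>p \<in> topspace ?X\<close>] \<open>k p \<noteq> 0\<close> by auto
    then have "s \<subseteq> ?supp p" using sV by auto
    then have "?supp p \<notin> L" using L by blast
    then show ?thesis using that(1) K unfolding topspace_realization by auto
  qed
  have hid: "h (t, p) = p" if "p \<in> extensional V" "k p = 0 \<or> t = 0" for t p
    using that unfolding h_def by (auto simp: extensional_def fun_eq_iff)
  have hsum: "sum (h (t, p)) V = sum p V" for t p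
  proof -
    have "sum (h (t, p)) V = sum p V + t * (k p * (\<Sum>v\<in>V. if v = x then real (card s) else 0) - k p * (\<Sum>v\<in>V. if v \<in> s then 1 else 0))"
      unfolding h_def by (simp add: sum.distrib sum_subtractf sum_distrib_left right_diff_distrib)
    moreover have "(\<Sum>v\<in>V. if v = x then real (card s) else 0) = card s" using V sV by simp
    moreover have "(\<Sum>v\<in>V. if v \<in> s then 1 else (0::real)) = card s"
      using V sV by (subst sum.inter_restrict[symmetric]) (auto simp: Int_absorb1)
    ultimately show ?thesis by simp
  qed
  have hsupp: "?supp (h (t, p)) \<subseteq> insert x s" if "p \<in> topspace ?X" "k p \<noteq> 0" for t p
    using kpos[OF that] unfolding h_def by auto
  have hnn: "0 \<le> h (t, p) v" if "p \<in> topspace ?X" "t \<in> {0..1}" "v \<in> V" for t p v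
  proof -
    have "t * k p \<le> 1 * k p" using that k0 by (intro mult_right_mono) auto
    then have "t * k p \<le> p v" if "v \<in> s" using kle[OF that, of p] by linarith
    moreover have "0 \<le> p v" using that unfolding topspace_realization by auto
    ultimately show ?thesis using that(2,3) s(2) k0[OF that(1)] unfolding h_def by auto
  qed
  have hX: "h (t, p) \<in> topspace ?X" if p: "p \<in> topspace ?X" and t: "t \<in> {0..1}" for t p
  proof (cases "k p = 0")
    case True
    then show ?thesis using hid[of p t] p unfolding topspace_realization by auto
  next
    case False
    have "insert x s \<in> K" using K by auto
    then have "?supp (h (t, p)) \<in> K" using hsupp[OF p False] down by blast
    moreover have "h (t, p) \<in> extensional V" unfolding h_def by auto
    ultimately show ?thesis
      using hsum[of t p] hnn[OF p t] p unfolding topspace_realization by auto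
  qed
  have hY: "h (1, p) \<in> topspace ?Y" if p: "p \<in> topspace ?X" for p
  proof -
    obtain v where v: "v \<in> s" "p v = k p" using kat by blast
    then have "h (1, p) v = 0" using sV s(2) unfolding h_def by auto
    then have "\<not> s \<subseteq> ?supp (h (1, p))" using v by auto
    moreover have "h (1, p) \<in> topspace ?X" using hX[OF p] by auto
    ultimately show ?thesis using K unfolding topspace_realization by auto
  qed
  have YX: "topspace ?Y \<subseteq> topspace ?X" using K unfolding topspace_realization by auto
  have Yk: "k p = 0" if "p \<in> topspace ?Y" for p
  proof (rule ccontr)
    assume "k p \<noteq> 0"
    then have "?supp p \<in> {s, insert x s}" using kpos YX that by blast
    moreover have "?supp p \<in> L" using that unfolding topspace_realization by auto
    ultimately show False using L by auto
  qed
  let ?I = "top_of_set {0..1::real}"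
  have cont: "continuous_map (prod_topology ?I ?X) ?X h"
    unfolding continuous_map_into_realization
  proof (intro conjI ballI)
    show "h \<in> topspace (prod_topology ?I ?X) \<rightarrow> topspace ?X" using hX by auto
    fix v assume v: "v \<in> V"
    have c: "continuous_map (prod_topology ?I ?X) euclideanreal (\<lambda>z. (snd z) w)" if "w \<in> V" for w
      using continuous_map_compose[OF continuous_map_snd continuous_map_realization_coordinate[OF that]]
      by (simp add: o_def)
    have ck: "continuous_map (prod_topology ?I ?X) euclideanreal (\<lambda>z. k (snd z))"
      unfolding k_def using sV by (intro continuous_map_Min fs s(1) c) auto
    have cf: "continuous_map (prod_topology ?I ?X) euclideanreal fst"
      by (rule continuous_map_into_fulltopology[OF continuous_map_fst])
    have "(\<lambda>z. h z v) = (\<lambda>z. (snd z) v + fst z * (k (snd z) * (if v = x then real (card s) else 0)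
       - k (snd z) * (if v \<in> s then 1 else 0)))" using v unfolding h_def by auto
    moreover have "continuous_map (prod_topology ?I ?X) euclideanreal \<dots>"
      by (intro continuous_intros c v ck cf)
    ultimately show "continuous_map (prod_topology ?I ?X) euclideanreal (\<lambda>z. h z v)" by simp
  qed
  have r: "continuous_map ?X ?Y (\<lambda>p. h (1, p))"
    unfolding continuous_map_into_realization
  proof (intro conjI ballI)
    have "continuous_map ?X (prod_topology ?I ?X) (\<lambda>p. (1, p))"
      by (auto intro!: continuous_map_pairedI)
    then have "continuous_map ?X ?X (\<lambda>p. h (1, p))"
      using continuous_map_compose[OF _ cont] by (auto simp: o_def)
    then show "continuous_map ?X euclideanreal (\<lambda>p. h (1, p) v)" if "v \<in> V" for v
      using that unfolding continuous_map_into_realization by auto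
  qed (use hY in auto)
  have "homotopic_with (\<lambda>x. True) ?X ?X id (\<lambda>p. h (1, p))"
    by (rule homotopic_withI[OF cont]) (use hid in \<open>simp_all add: topspace_realization\<close>)
  moreover have "retraction_maps ?X ?Y (\<lambda>p. h (1, p)) id"
    unfolding retraction_maps_def
  proof (intro conjI ballI r)
    show "continuous_map ?Y ?X id"
      unfolding continuous_map_into_realization
      using YX continuous_map_realization_coordinate by auto
    show "h (1, id p) = p" if "p \<in> topspace ?Y" for p
      using hid Yk[OF that] that unfolding topspace_realization by auto
  qed
  ultimately show ?thesis
    using deformation_retract_imp_homotopy_equivalent_space homotopic_with_sym by blast
qed

text \<open>Every pair with nonempty \<open>s\<close> is an elementary collapse. The pair with
  \<open>s = {}\<close> is the last one to be removed and corresponds to a single point.\<close>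

lemma void_collapsible_imp_contractible:
  assumes "void_collapsible K" and V: "finite V" and "K \<subseteq> Pow V" "K \<noteq> {}"
    and "\<And>s t. t \<in> K \<Longrightarrow> s \<subseteq> t \<Longrightarrow> s \<in> K"
  shows "contractible_space (realization V K)" "topspace (realization V K) \<noteq> {}"
proof -
  have "contractible_space (realization V K) \<and> topspace (realization V K) \<noteq> {}"
    using assms(1,3-5)
  proof (induction rule: void_collapsible.induct)
    case empty
    then show ?case by simp
  next
    case (pair L x s)
    let ?K = "insert s (insert (insert x s) L)"
    have KV: "?K \<subseteq> Pow V" by fact
    have down: "u \<in> ?K" if "t \<in> ?K" "u \<subseteq> t" for u t using pair.prems(3)[OF that] .
    show ?case
    proof (cases "s = {}")
      case True
      let ?p = "restrict (\<lambda>v. if v = x then 1 else (0::real)) V"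
      \<comment> \<open>Every set contains \<open>{}\<close>, so freeness of the pair leaves no
        other face.\<close>
      have "L = {}" using pair.hyps(3) True by auto
      then have K: "?K = {{}, {x}}" using True by auto
      have xV: "x \<in> V" using KV by auto
      have "p = ?p" if p: "p \<in> topspace (realization V ?K)" for p
      proof -
        have e: "p \<in> extensional V" "sum p V = 1" and supp: "{v \<in> V. p v \<noteq> 0} \<in> {{}, {x}}"
          using p unfolding topspace_realization K by auto
        have z: "p v = 0" if "v \<in> V" "v \<noteq> x" for v using supp that by auto
        have "sum p V = p x + sum p (V - {x})" using V xV by (simp add: sum.remove)
        also have "sum p (V - {x}) = 0" using z by (intro sum.neutral) auto
        finally have "p x = 1" using e by simp
        then show ?thesis using e z by (auto simp: fun_eq_iff extensional_def)
      qed
      then have "topspace (realization V ?K) \<subseteq> {?p}" by auto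
      then have "contractible_space (realization V ?K)" by (rule contractible_space_subset_singleton)
      moreover have "{v \<in> V. ?p v \<noteq> 0} = {x}" "sum ?p V = 1" using xV V by auto
      then have "?p \<in> topspace (realization V ?K)"
        unfolding topspace_realization K by simp
      ultimately show ?thesis by blast
    next
      case False
      have dL: "u \<in> L" if "t \<in> L" "u \<subseteq> t" for u t
      proof -
        have "u \<in> ?K" using down[of t u] that by auto
        moreover have "\<not> s \<subseteq> u" using pair.hyps(3)[OF that(1)] that(2) by auto
        ultimately show ?thesis by auto
      qed
      have "{} \<in> ?K" using down[of s "{}"] by auto
      then have "L \<noteq> {}" using False by auto
      then have IH: "contractible_space (realization V L)" "topspace (realization V L) \<noteq> {}"
        using pair.IH KV dL by auto
      have "realization V ?K homotopy_equivalent_space realization V L"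
        by (rule elementary_collapse_homotopy_equivalent[OF V KV down refl False pair.hyps(2,3)])
      then have "contractible_space (realization V ?K)"
        using IH homotopy_equivalent_space_contractibility by blast
      moreover have "topspace (realization V L) \<subseteq> topspace (realization V ?K)"
        unfolding topspace_realization by auto
      ultimately show ?thesis using IH by blast
    qed
  qed
  then show "contractible_space (realization V K)" "topspace (realization V K) \<noteq> {}" by auto
qed


section \<open>Collapsing a contractible subcomplex\<close>

text \<open>If the inclusion of \<open>L\<close> extends to a homotopy of \<open>X\<close> that contracts \<open>L\<close> within itself, then
  collapsing \<open>L\<close> to a point does not change the homotopy type.\<close>

lemma homotopy_equivalent_space_collapse:
  assumes q: "quotient_map X Y q"
    and H: "continuous_map (prod_topology (top_of_set {0..1::real}) X) X H"
    and H0: "\<And>x. x \<in> topspace X \<Longrightarrow> H (0, x) = x"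
    and HL: "\<And>t x. t \<in> {0..1} \<Longrightarrow> x \<in> L \<Longrightarrow> H (t, x) \<in> L"
    and H1: "\<And>x. x \<in> L \<Longrightarrow> H (1, x) = c"
    and LX: "L \<subseteq> topspace X"
    and inj: "\<And>x y. x \<in> topspace X \<Longrightarrow> y \<in> topspace X \<Longrightarrow> q x = q y \<Longrightarrow> x = y \<or> x \<in> L \<and> y \<in> L"
    and const: "\<And>x y. x \<in> L \<Longrightarrow> y \<in> L \<Longrightarrow> q x = q y"
  shows "X homotopy_equivalent_space Y"
proof -
  let ?I = "top_of_set {0..1::real}"
  define sel where "sel y = (SOME x. x \<in> topspace X \<and> q x = y)" for y
  have sel: "sel y \<in> topspace X" "q (sel y) = y" if "y \<in> topspace Y" for y
  proof -
    have "\<exists>x. x \<in> topspace X \<and> q x = y" using quotient_imp_surjective_map[OF q] that by (metis imageE)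
    then have "sel y \<in> topspace X \<and> q (sel y) = y" unfolding sel_def by (rule someI_ex)
    then show "sel y \<in> topspace X" "q (sel y) = y" by auto
  qed
  have qX: "q x \<in> topspace Y" if "x \<in> topspace X" for x
    using quotient_imp_surjective_map[OF q] that by auto
  have selq: "sel (q x) = x \<or> sel (q x) \<in> L \<and> x \<in> L" if "x \<in> topspace X" for x
    using inj[of "sel (q x)" x] sel[OF qX[OF that]] that by auto
  define g where "g y = H (1, sel y)" for y
  define G where "G = (\<lambda>(t, y). q (H (t, sel y)))"
  have gq: "g (q x) = H (1, x)" if "x \<in> topspace X" for x
    using selq[OF that] H1 unfolding g_def by auto
  have Gq: "G (t, q x) = q (H (t, x))" if "x \<in> topspace X" "t \<in> {0..1}" for t x
    using selq[OF that(1)] const[OF HL HL] that unfolding G_def by auto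
  have cq: "continuous_map X Y q" using q by (rule quotient_imp_continuous_map)
  have c1: "continuous_map X X (\<lambda>x. H (1, x))"
  proof -
    have "continuous_map X (prod_topology ?I X) (\<lambda>x. (1, x))"
      by (auto intro!: continuous_map_pairedI)
    then show ?thesis using continuous_map_compose[OF _ H] by (auto simp: o_def)
  qed
  have cg: "continuous_map Y X g"
  proof (rule continuous_compose_quotient_map[OF q])
    show "continuous_map X X (g \<circ> q)"
      by (rule continuous_map_eq[OF c1]) (simp add: gq)
  qed
  have cG: "continuous_map (prod_topology ?I Y) Y G"
  proof (rule continuous_compose_quotient_map)
    have "locally_compact_space ?I"
      by (intro compact_imp_locally_compact_space) (auto simp: compact_space_subtopology)
    then show "quotient_map (prod_topology ?I X) (prod_topology ?I Y) (\<lambda>(t, x). (t, q x))"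
      by (intro quotient_map_prod_right q) (auto simp: Hausdorff_space_subtopology)
    have "continuous_map (prod_topology ?I X) Y (q \<circ> H)"
      using continuous_map_compose[OF H cq] .
    then show "continuous_map (prod_topology ?I X) Y (G \<circ> (\<lambda>(t, x). (t, q x)))"
      by (rule continuous_map_eq) (auto simp: Gq)
  qed
  show ?thesis
    unfolding homotopy_equivalent_space_def
  proof (intro exI conjI)
    show "homotopic_with (\<lambda>x. True) X X (g \<circ> q) id"
      by (rule homotopic_with_symD, rule homotopic_withI[OF H]) (auto simp: H0 gq)
    show "homotopic_with (\<lambda>x. True) Y Y (q \<circ> g) id"
      by (rule homotopic_with_symD, rule homotopic_withI[OF cG]) (use sel in \<open>auto simp: G_def g_def H0\<close>)
  qed (fact cq cg)+
qed

section \<open>Removing open facets from a realization\<close>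

locale facet_family =
  fixes V :: "'a set" and K \<Phi> :: "'a set set"
  assumes V: "finite V" and KV: "K \<subseteq> Pow V" and down: "\<And>s t. t \<in> K \<Longrightarrow> s \<subseteq> t \<Longrightarrow> s \<in> K"
    and \<Phi>K: "\<Phi> \<subseteq> K" and facet: "\<And>f t. f \<in> \<Phi> \<Longrightarrow> t \<in> K \<Longrightarrow> f \<subseteq> t \<Longrightarrow> t = f"
    and nonempty: "{} \<notin> \<Phi>"
begin

text \<open>The depth of a point in the facet \<open>f\<close>: on the realization of
  \<open>K\<close> it is positive exactly on the open simplex of \<open>f\<close>. The realization
  of \<open>K - \<Phi>\<close> is thus the common zero set of the weights.\<close>

definition weight :: "('a \<Rightarrow> real) \<Rightarrow> 'a set \<Rightarrow> real" where
  "weight p f = Min (p ` f)"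

lemma facet_subset: "f \<in> \<Phi> \<Longrightarrow> f \<subseteq> V" and finite_facet: "f \<in> \<Phi> \<Longrightarrow> finite f"
  and facet_nonempty: "f \<in> \<Phi> \<Longrightarrow> f \<noteq> {}" and finite_facets: "finite \<Phi>"
proof -
  show s: "f \<subseteq> V" if "f \<in> \<Phi>" for f using that KV \<Phi>K by auto
  show "finite f" if "f \<in> \<Phi>" for f using s[OF that] V finite_subset by auto
  show "f \<noteq> {}" if "f \<in> \<Phi>" for f using that nonempty by auto
  show "finite \<Phi>" using KV \<Phi>K V by (meson finite_Pow_iff finite_subset)
qed

lemma card_facet_pos: "f \<in> \<Phi> \<Longrightarrow> 0 < card f"
  using finite_facet facet_nonempty by (simp add: card_gt_0_iff)

lemma weight_le: "f \<in> \<Phi> \<Longrightarrow> v \<in> f \<Longrightarrow> weight p f \<le> p v"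
  unfolding weight_def using Min_image_facts(1)[OF finite_facet facet_nonempty] .

lemma weight_attained: "f \<in> \<Phi> \<Longrightarrow> \<exists>v\<in>f. p v = weight p f"
  unfolding weight_def using Min_image_facts(2)[OF finite_facet facet_nonempty] .

lemma realization_nonneg:
  "p \<in> topspace (realization V K) \<Longrightarrow> v \<in> V \<Longrightarrow> 0 \<le> p v"
  unfolding topspace_realization by auto

lemma weight_nonneg:
  assumes "p \<in> topspace (realization V K)" "f \<in> \<Phi>"
  shows "0 \<le> weight p f"
  using weight_attained[OF assms(2), of p] facet_subset[OF assms(2)] realization_nonneg[OF assms(1)]
  by fastforce

lemma support_eq_facet:
  assumes "p \<in> topspace (realization V K)" "f \<in> \<Phi>" "weight p f \<noteq> 0"
  shows "{v \<in> V. p v \<noteq> 0} = f"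
proof (rule facet[OF assms(2)])
  show "{v \<in> V. p v \<noteq> 0} \<in> K" using assms(1) unfolding topspace_realization by auto
  have "p v \<noteq> 0" if "v \<in> f" for v
    using weight_le[OF assms(2) that, of p] weight_nonneg[OF assms(1,2)] assms(3) by auto
  then show "f \<subseteq> {v \<in> V. p v \<noteq> 0}" using facet_subset[OF assms(2)] by auto
qed

lemma weight_unique:
  assumes "p \<in> topspace (realization V K)" "f \<in> \<Phi>" "weight p f \<noteq> 0" "g \<in> \<Phi>" "g \<noteq> f"
  shows "weight p g = 0"
  using support_eq_facet[OF assms(1-3)] support_eq_facet[OF assms(1,4)] assms(5) by auto

lemma topspace_realization_Diff:
  "topspace (realization V (K - \<Phi>)) = {p \<in> topspace (realization V K). \<forall>f\<in>\<Phi>. weight p f = 0}"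
proof -
  have "({v \<in> V. p v \<noteq> 0} \<notin> \<Phi>) = (\<forall>f\<in>\<Phi>. weight p f = 0)" if p: "p \<in> topspace (realization V K)" for p
  proof
    assume "{v \<in> V. p v \<noteq> 0} \<notin> \<Phi>"
    then show "\<forall>f\<in>\<Phi>. weight p f = 0" using support_eq_facet[OF p] by auto
  next
    assume w: "\<forall>f\<in>\<Phi>. weight p f = 0"
    show "{v \<in> V. p v \<noteq> 0} \<notin> \<Phi>"
    proof
      assume "{v \<in> V. p v \<noteq> 0} \<in> \<Phi>"
      then show False using weight_attained[of "{v \<in> V. p v \<noteq> 0}" p] w by auto
    qed
  qed
  moreover have "p \<in> topspace (realization V (K - \<Phi>)) \<longleftrightarrow> p \<in> topspace (realization V K) \<and> {v \<in> V. p v \<noteq> 0} \<notin> \<Phi>" for p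
    unfolding topspace_realization by auto
  ultimately show ?thesis by auto
qed

lemma continuous_map_weight:
  assumes "f \<in> \<Phi>"
  shows "continuous_map (realization V K) euclideanreal (\<lambda>p. weight p f)"
  unfolding weight_def
  using facet_subset[OF assms]
  by (intro continuous_map_Min finite_facet facet_nonempty assms continuous_map_realization_coordinate) auto

text \<open>At time \<open>s\<close>, a collar of the boundary of every facet, of width proportional to \<open>s\<close>, is pushed
  onto the boundary and then moved by the contraction, for a time that vanishes at the inner end of
  the collar.\<close>

lemma contraction_extends:
  assumes h: "continuous_map (prod_topology (top_of_set {0..1::real}) (realization V (K - \<Phi>))) (realization V (K - \<Phi>)) h"
    and h0: "\<And>p. p \<in> topspace (realization V (K - \<Phi>)) \<Longrightarrow> h (0, p) = p"
  obtains H where "continuous_map (prod_topology (top_of_set {0..1::real}) (realization V K)) (realization V K) H"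
    "\<And>p. p \<in> topspace (realization V K) \<Longrightarrow> H (0, p) = p"
    "\<And>t p. t \<in> {0..1} \<Longrightarrow> p \<in> topspace (realization V (K - \<Phi>)) \<Longrightarrow> H (t, p) = h (t, p)"
proof -
  let ?I = "top_of_set {0..1::real}" and ?X = "realization V K" and ?L = "realization V (K - \<Phi>)"
  let ?Z = "prod_topology ?I ?X"
  \<comment> \<open>Subtracting \<open>a f\<close> from the coordinates in \<open>f\<close> and
    rescaling pushes away from the barycentre. The factor 2 keeps the removed mass \<open>W\<close>
    at most 1/2, so the division by \<open>1 - W\<close> is safe.\<close>
  define a where "a f = (\<lambda>(s::real, p). min (weight p f) (s / (2 * real (card f))))" for f
  define W where "W z = (\<Sum>f\<in>\<Phi>. a f z * real (card f))" for z
  define \<phi> where "\<phi> z = restrict (\<lambda>v. (snd z v - (\<Sum>f\<in>\<Phi>. a f z * (if v \<in> f then 1 else 0))) / (1 - W z)) V" for z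
  \<comment> \<open>On an open facet this is nonnegative exactly where \<open>a f\<close> equals the
    weight, that is, where \<open>\<phi>\<close> has reached the boundary. It is zero at the inner
    end of the collar and equals \<open>s\<close> on the subcomplex.\<close>
  define \<tau> where "\<tau> = (\<lambda>(s::real, p). s - 2 * (\<Sum>f\<in>\<Phi>. real (card f) * weight p f))"
  have LX: "topspace ?L \<subseteq> topspace ?X" unfolding topspace_realization_Diff by auto
  have a0: "a f (s, p) = 0" if "weight p f = 0" "0 \<le> s" for f s p
    using that unfolding a_def by (auto simp: min_def)
  have onL: "W (s, p) = 0" "\<phi> (s, p) = p" "\<tau> (s, p) = s" if p: "p \<in> topspace ?L" and s: "0 \<le> s" for s p
  proof -
    have w: "\<And>f. f \<in> \<Phi> \<Longrightarrow> weight p f = 0" using p unfolding topspace_realization_Diff by auto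
    then show W0: "W (s, p) = 0" unfolding W_def using a0 s by (intro sum.neutral) auto
    have e: "p \<in> extensional V" using p unfolding topspace_realization by auto
    have "(\<Sum>f\<in>\<Phi>. a f (s, p) * (if v \<in> f then 1 else 0)) = 0" for v
      using a0 s w by (intro sum.neutral) auto
    then show "\<phi> (s, p) = p" unfolding \<phi>_def using W0 e by (auto simp: extensional_def fun_eq_iff)
    show "\<tau> (s, p) = s" unfolding \<tau>_def using w by (auto intro!: sum.neutral)
  qed
  \<comment> \<open>Sums over all facets make continuity evident; since a point lies in at most one
    open facet, they have at most one nonzero term.\<close>
  have single: "(\<Sum>f\<in>\<Phi>. c f) = c g"
    if "p \<in> topspace ?X" "g \<in> \<Phi>" "weight p g \<noteq> 0" "\<And>f. f \<in> \<Phi> \<Longrightarrow> weight p f = 0 \<Longrightarrow> c f = 0" for c :: "'a set \<Rightarrow> real" and p g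
  proof -
    have "(\<Sum>f\<in>\<Phi>. c f) = c g + (\<Sum>f\<in>\<Phi> - {g}. c f)" using finite_facets that(2) by (rule sum.remove)
    also have "(\<Sum>f\<in>\<Phi> - {g}. c f) = 0" using that(4) weight_unique[OF that(1,2,3)] by (intro sum.neutral) auto
    finally show ?thesis by simp
  qed
  have off: "\<phi> (s, p) \<in> topspace ?X \<and> W (s, p) < 1 \<and> (\<tau> (s, p) \<ge> 0 \<longrightarrow> \<phi> (s, p) \<in> topspace ?L)
      \<and> (s = 0 \<longrightarrow> \<phi> (s, p) = p)"
    if p: "p \<in> topspace ?X" and s: "0 \<le> s" "s \<le> 1" and g: "g \<in> \<Phi>" "weight p g \<noteq> 0" for s p g
  proof -
    let ?a = "a g (s, p)" and ?n = "real (card g)"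
    have n: "0 < ?n" using card_facet_pos[OF g(1)] by simp
    have wg: "0 \<le> weight p g" using weight_nonneg[OF p g(1)] .
    have gV: "g \<subseteq> V" using facet_subset g by auto
    have supp: "{v \<in> V. p v \<noteq> 0} = g" using support_eq_facet[OF p g] .
    have W: "W (s, p) = ?a * ?n" unfolding W_def by (rule single[OF p g]) (simp add: a0 s)
    have \<phi>: "\<phi> (s, p) = restrict (\<lambda>v. (p v - ?a * (if v \<in> g then 1 else 0)) / (1 - ?a * ?n)) V"
    proof -
      have "(\<Sum>f\<in>\<Phi>. a f (s, p) * (if v \<in> f then 1 else 0)) = ?a * (if v \<in> g then 1 else 0)" for v
        by (rule single[OF p g]) (simp add: a0 s)
      then show ?thesis unfolding \<phi>_def W by simp
    qed
    have \<tau>: "\<tau> (s, p) = s - 2 * (?n * weight p g)"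
    proof -
      have "(\<Sum>f\<in>\<Phi>. real (card f) * weight p f) = ?n * weight p g"
        by (rule single[OF p g]) simp
      then show ?thesis unfolding \<tau>_def by simp
    qed
    have "?a * ?n \<le> s / (2 * ?n) * ?n" unfolding a_def using n by (intro mult_right_mono) auto
    also have "\<dots> = s / 2" using n by simp
    finally have an: "?a * ?n \<le> 1 / 2" using s by simp
    have aw: "?a \<le> weight p g" unfolding a_def by simp
    have ext: "\<phi> (s, p) \<in> extensional V" unfolding \<phi> by simp
    have nn: "0 \<le> \<phi> (s, p) v" if "v \<in> V" for v
    proof -
      have "?a * (if v \<in> g then 1 else 0) \<le> p v"
        using aw weight_le[OF g(1), of v p] realization_nonneg[OF p that] by (cases "v \<in> g") auto
      then show ?thesis unfolding \<phi> using that an by simp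
    qed
    have "(\<Sum>v\<in>V. if v \<in> g then 1 else (0::real)) = ?n"
      using V gV by (subst sum.inter_restrict[symmetric]) (auto simp: Int_absorb1)
    then have "sum (\<phi> (s, p)) V = (sum p V - ?a * ?n) / (1 - ?a * ?n)"
      unfolding \<phi> by (simp add: sum_subtractf sum_distrib_left[symmetric] sum_divide_distrib[symmetric])
    also have "sum p V = 1" using p unfolding topspace_realization by auto
    finally have s1: "sum (\<phi> (s, p)) V = 1" using an by simp
    have "v \<in> g" if "v \<in> V" "\<phi> (s, p) v \<noteq> 0" for v
    proof (rule ccontr)
      assume "v \<notin> g"
      then have "p v = 0" using supp that(1) by auto
      then show False using that \<open>v \<notin> g\<close> unfolding \<phi> by simp
    qed
    then have sub: "{v \<in> V. \<phi> (s, p) v \<noteq> 0} \<subseteq> g" by auto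
    then have mK: "{v \<in> V. \<phi> (s, p) v \<noteq> 0} \<in> K" using down g(1) \<Phi>K by blast
    have X: "\<phi> (s, p) \<in> topspace ?X" using ext nn s1 mK unfolding topspace_realization by auto
    have L: "\<phi> (s, p) \<in> topspace ?L" if "\<tau> (s, p) \<ge> 0"
    proof -
      have "weight p g \<le> s / (2 * ?n)" using that \<tau> n by (simp add: field_simps)
      then have aeq: "?a = weight p g" unfolding a_def by simp
      obtain v where v: "v \<in> g" "p v = weight p g" using weight_attained[OF g(1)] by blast
      then have "\<phi> (s, p) v = 0" unfolding \<phi> aeq using gV by auto
      then have "{v \<in> V. \<phi> (s, p) v \<noteq> 0} \<noteq> g" using v by auto
      then have "{v \<in> V. \<phi> (s, p) v \<noteq> 0} \<notin> \<Phi>" using facet[of _ g] sub g(1) \<Phi>K by blast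
      then show ?thesis using ext nn s1 mK unfolding topspace_realization by auto
    qed
    have "\<phi> (s, p) = p" if "s = 0"
    proof -
      have "?a = 0" unfolding a_def using that wg by simp
      moreover have "p \<in> extensional V" using p unfolding topspace_realization by auto
      ultimately show ?thesis unfolding \<phi> by (auto simp: extensional_def fun_eq_iff)
    qed
    then show ?thesis using X L an W by simp
  qed
  have all: "\<phi> (s, p) \<in> topspace ?X" "W (s, p) < 1" "\<tau> (s, p) \<ge> 0 \<Longrightarrow> \<phi> (s, p) \<in> topspace ?L"
      "s = 0 \<Longrightarrow> \<phi> (s, p) = p"
    if p: "p \<in> topspace ?X" and s: "s \<in> {0..1}" for s p
  proof -
    have "\<phi> (s, p) \<in> topspace ?X \<and> W (s, p) < 1 \<and> (\<tau> (s, p) \<ge> 0 \<longrightarrow> \<phi> (s, p) \<in> topspace ?L)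
      \<and> (s = 0 \<longrightarrow> \<phi> (s, p) = p)"
    proof (cases "p \<in> topspace ?L")
      case True
      then show ?thesis using onL[OF True, of s] s p by auto
    next
      case False
      then obtain g where "g \<in> \<Phi>" "weight p g \<noteq> 0" using p unfolding topspace_realization_Diff by auto
      then show ?thesis using off[OF p] s by auto
    qed
    then show "\<phi> (s, p) \<in> topspace ?X" "W (s, p) < 1" "\<tau> (s, p) \<ge> 0 \<Longrightarrow> \<phi> (s, p) \<in> topspace ?L"
      "s = 0 \<Longrightarrow> \<phi> (s, p) = p" by auto
  qed
  have \<tau>le: "\<tau> (s, p) \<le> s" if "p \<in> topspace ?X" for s p
    unfolding \<tau>_def using weight_nonneg[OF that] by (auto intro!: sum_nonneg)
  have cw: "continuous_map ?Z euclideanreal (\<lambda>z. weight (snd z) f)" if "f \<in> \<Phi>" for f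
    using continuous_map_compose[OF continuous_map_snd continuous_map_weight[OF that]] by (simp add: o_def)
  have cc: "continuous_map ?Z euclideanreal (\<lambda>z. snd z v)" if "v \<in> V" for v
    using continuous_map_compose[OF continuous_map_snd continuous_map_realization_coordinate[OF that]]
    by (simp add: o_def)
  have cf: "continuous_map ?Z euclideanreal fst"
    by (rule continuous_map_into_fulltopology[OF continuous_map_fst])
  have ca: "continuous_map ?Z euclideanreal (a f)" if "f \<in> \<Phi>" for f
    unfolding a_def case_prod_unfold using card_facet_pos[OF that]
    by (intro continuous_intros cw cf that) auto
  have cW: "continuous_map ?Z euclideanreal W"
    unfolding W_def by (intro continuous_intros ca finite_facets) auto
  have c\<tau>: "continuous_map ?Z euclideanreal \<tau>"
    unfolding \<tau>_def case_prod_unfold by (intro continuous_intros cf cw finite_facets) auto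
  have c\<phi>v: "continuous_map ?Z euclideanreal (\<lambda>z. \<phi> z v)" if "v \<in> V" for v
  proof -
    have "(\<lambda>z. \<phi> z v) = (\<lambda>z. (snd z v - (\<Sum>f\<in>\<Phi>. a f z * (if v \<in> f then 1 else 0))) / (1 - W z))"
      unfolding \<phi>_def using that by simp
    moreover have "continuous_map ?Z euclideanreal \<dots>"
    proof (intro continuous_intros cc cW ca finite_facets that)
      fix z assume "z \<in> topspace ?Z"
      then show "1 - W z \<noteq> 0" using all(2)[of "snd z" "fst z"] by force
    qed auto
    ultimately show ?thesis by simp
  qed
  have c\<phi>: "continuous_map ?Z ?X \<phi>"
    unfolding continuous_map_into_realization using all(1) c\<phi>v by auto
  \<comment> \<open>Two closed pieces, with the contraction on the one indexed by
    \<open>True\<close>. They overlap where \<open>\<tau>\<close> is zero, and there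
    \<open>h\<close> is the identity.\<close>
  define T where "T (b::bool) = {z \<in> topspace ?Z. \<tau> z \<in> (if b then {0..} else {..0})}" for b
  define F where "F b z = (if b then h (\<tau> z, \<phi> z) else \<phi> z)" for b :: bool and z
  define H where "H z = F (0 \<le> \<tau> z) z" for z
  have cH: "continuous_map ?Z ?X H"
  proof (rule pasting_lemma_closed[where I = UNIV and T = T and f = F])
    show "closedin ?Z (T b)" for b
      unfolding T_def by (rule closedin_continuous_map_preimage[OF c\<tau>]) auto
    show "continuous_map (subtopology ?Z (T b)) ?X (F b)" for b
    proof (cases b)
      case True
      have tp: "topspace (subtopology ?Z (T True)) = T True" unfolding T_def by auto
      have 1: "continuous_map (subtopology ?Z (T True)) ?L \<phi>"
        unfolding continuous_map_into_realization
      proof (intro conjI ballI)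
        show "\<phi> \<in> topspace (subtopology ?Z (T True)) \<rightarrow> topspace ?L"
          unfolding tp T_def using all(3) by auto
        show "continuous_map (subtopology ?Z (T True)) euclideanreal (\<lambda>x. \<phi> x v)" if "v \<in> V" for v
          by (rule continuous_map_from_subtopology[OF c\<phi>v[OF that]])
      qed
      have \<tau>1: "\<tau> z \<le> 1" if z: "z \<in> topspace ?Z" for z
        using \<tau>le[of "snd z" "fst z"] z by force
      have 2: "continuous_map (subtopology ?Z (T True)) ?I \<tau>"
        unfolding continuous_map_in_subtopology
        using continuous_map_from_subtopology[OF c\<tau>] \<tau>1 unfolding tp T_def by auto
      have "continuous_map (subtopology ?Z (T True)) ?L (h \<circ> (\<lambda>z. (\<tau> z, \<phi> z)))"
        by (rule continuous_map_compose[OF _ h]) (intro continuous_map_pairedI 1 2)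
      moreover have "continuous_map ?L ?X id"
        unfolding continuous_map_into_realization using LX continuous_map_realization_coordinate by auto
      ultimately have "continuous_map (subtopology ?Z (T True)) ?X (id \<circ> (h \<circ> (\<lambda>z. (\<tau> z, \<phi> z))))"
        by (rule continuous_map_compose)
      then show ?thesis using True unfolding F_def by (simp add: o_def)
    next
      case False
      then show ?thesis unfolding F_def using continuous_map_from_subtopology[OF c\<phi>] by simp
    qed
    show "F i x = F j x" if ij: "x \<in> topspace ?Z \<inter> T i \<inter> T j" for i j x
    proof (cases "i = j")
      case False
      then have "\<tau> x = 0" using ij unfolding T_def by (auto split: if_splits)
      moreover have "\<phi> x \<in> topspace ?L" using all(3)[of "snd x" "fst x"] ij calculation by force
      ultimately show ?thesis unfolding F_def using h0 by auto
    qed simp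
    show "\<exists>j. j \<in> UNIV \<and> x \<in> T j \<and> H x = F j x" if "x \<in> topspace ?Z" for x
      using that unfolding H_def T_def by (intro exI[of _ "0 \<le> \<tau> x"]) auto
  qed simp
  show ?thesis
  proof (rule that[OF cH])
    show "H (0, p) = p" if p: "p \<in> topspace ?X" for p
    proof -
      have e: "\<phi> (0, p) = p" using all(4)[OF p] by simp
      have "h (\<tau> (0, p), \<phi> (0, p)) = p" if t: "0 \<le> \<tau> (0, p)"
      proof -
        have "\<tau> (0, p) = 0" using \<tau>le[OF p, of 0] t by simp
        moreover have "p \<in> topspace ?L" using all(3)[OF p, of 0] t e by simp
        ultimately show ?thesis using e h0 by simp
      qed
      then show ?thesis unfolding H_def F_def using e by simp
    qed
    show "H (t, p) = h (t, p)" if "t \<in> {0..1}" "p \<in> topspace ?L" for t p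
      using onL[OF that(2), of t] that(1) unfolding H_def F_def by simp
  qed
qed

end


section \<open>An explicit quotient map from a simplex to a sphere\<close>

text \<open>The interior of the simplex spanned by vertices \<open>0, \<dots>, n\<close> is mapped to the open half space
  by taking half the minimal barycentric coordinate together with the differences to the coordinate
  of vertex \<open>0\<close>; inversion in the origin then carries the half space to a sphere through the origin,
  with the origin removed. The last summand of \<open>chart_denom\<close> vanishes on the simplex and keeps the
  denominator positive on its complement.\<close>

definition min_coord :: "nat \<Rightarrow> (nat \<Rightarrow> real) \<Rightarrow> real" where
  "min_coord n a = Min (a ` {..n})"

definition chart_dir :: "nat \<Rightarrow> (nat \<Rightarrow> real) \<Rightarrow> nat \<Rightarrow> real" where
  "chart_dir n a j = (if j = 0 then min_coord n a / 2 else a j - a 0)"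

definition chart_denom :: "nat \<Rightarrow> (nat \<Rightarrow> real) \<Rightarrow> real" where
  "chart_denom n a = (\<Sum>j\<le>n. (chart_dir n a j)\<^sup>2) + (1 - (\<Sum>j\<le>n. a j))\<^sup>2"

definition chart :: "nat \<Rightarrow> (nat \<Rightarrow> real) \<Rightarrow> nat \<Rightarrow> real" where
  "chart n a j = min_coord n a * chart_dir n a j / chart_denom n a"

lemma min_coord_le: "j \<le> n \<Longrightarrow> min_coord n a \<le> a j"
  unfolding min_coord_def by (intro Min_le) auto

lemma min_coord_attained: "\<exists>j\<le>n. a j = min_coord n a"
proof -
  have "min_coord n a \<in> a ` {..n}" unfolding min_coord_def by (intro Min_in) auto
  then show ?thesis by auto
qed

lemma min_coord_eqI: "(\<And>j. j \<le> n \<Longrightarrow> m \<le> a j) \<Longrightarrow> k \<le> n \<Longrightarrow> a k = m \<Longrightarrow> min_coord n a = m"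
  unfolding min_coord_def by (intro Min_eqI) auto

text \<open>If the sum of squares vanishes, all coordinates are equal and their minimum is 0, so
  they are all 0; but then the last summand is 1.\<close>

lemma chart_denom_pos:
  assumes "\<And>j. j \<le> n \<Longrightarrow> 0 \<le> a j"
  shows "0 < chart_denom n a"
proof -
  have nn: "0 \<le> (\<Sum>j\<le>n. (chart_dir n a j)\<^sup>2)" by (intro sum_nonneg) auto
  have "chart_denom n a \<noteq> 0"
  proof
    assume z: "chart_denom n a = 0"
    then have "(\<Sum>j\<le>n. (chart_dir n a j)\<^sup>2) = 0" and s: "(1 - (\<Sum>j\<le>n. a j))\<^sup>2 = 0"
      using nn unfolding chart_denom_def by (auto simp: add_nonneg_eq_0_iff)
    then have d: "chart_dir n a j = 0" if "j \<le> n" for j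
      using that by (simp add: sum_nonneg_eq_0_iff)
    have m: "min_coord n a = 0" using d[of 0] unfolding chart_dir_def by simp
    have eq: "a j = a 0" if "j \<le> n" for j using d[OF that] unfolding chart_dir_def by (auto split: if_splits)
    obtain k where "k \<le> n" "a k = 0" using min_coord_attained[of n a] m by auto
    then have "a j = 0" if "j \<le> n" for j using eq that by metis
    then have "(\<Sum>j\<le>n. a j) = 0" by (intro sum.neutral) auto
    then show False using s by simp
  qed
  then show ?thesis using nn unfolding chart_denom_def by (simp add: order_less_le)
qed

lemma chart_eq_0: "min_coord n a = 0 \<Longrightarrow> chart n a j = 0"
  unfolding chart_def by simp

lemma chart_0_pos:
  assumes "\<And>j. j \<le> n \<Longrightarrow> 0 \<le> a j" "0 < min_coord n a"
  shows "0 < chart n a 0"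
  unfolding chart_def chart_dir_def using assms chart_denom_pos[of n a] by simp

text \<open>In the form on the right, squared norm against a linear function, the sphere is visibly
  the inverse of a hyperplane.\<close>

lemma sphere_equation_iff:
  fixes x :: "nat \<Rightarrow> real"
  shows "(x 0 - 1)\<^sup>2 + (\<Sum>j\<in>{1..n}. (x j)\<^sup>2) = 1 \<longleftrightarrow> (\<Sum>j\<le>n. (x j)\<^sup>2) = 2 * x 0"
proof -
  have "{..n} = insert 0 {1..n}" by auto
  then have "(\<Sum>j\<le>n. (x j)\<^sup>2) = (x 0)\<^sup>2 + (\<Sum>j\<in>{1..n}. (x j)\<^sup>2)" by simp
  then show ?thesis by (auto simp: power2_eq_square algebra_simps)
qed

lemma chart_denom_simplex:
  "(\<Sum>j\<le>n. a j) = 1 \<Longrightarrow> chart_denom n a = (\<Sum>j\<le>n. (chart_dir n a j)\<^sup>2)"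
  unfolding chart_denom_def by simp

text \<open>With \<open>w\<close> the direction and \<open>m\<close> the minimum, the chart is
  \<open>m\<close> times \<open>w\<close> divided by the squared norm of \<open>w\<close>. Its
  squared norm is twice its coordinate 0 because \<open>m\<close> is twice \<open>w 0\<close>; this
  is where the half in \<open>chart_dir\<close> comes from.\<close>

lemma chart_on_sphere:
  assumes nn: "\<And>j. j \<le> n \<Longrightarrow> 0 \<le> a j" and s: "(\<Sum>j\<le>n. a j) = 1"
  shows "(chart n a 0 - 1)\<^sup>2 + (\<Sum>j\<in>{1..n}. (chart n a j)\<^sup>2) = 1"
proof -
  let ?D = "chart_denom n a" and ?m = "min_coord n a"
  have D: "?D > 0" using chart_denom_pos[of n a] nn by simp
  have "(\<Sum>j\<le>n. (chart n a j)\<^sup>2) = (\<Sum>j\<le>n. (?m / ?D)\<^sup>2 * (chart_dir n a j)\<^sup>2)"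
    unfolding chart_def by (simp add: power_divide power_mult_distrib)
  also have "\<dots> = (?m / ?D)\<^sup>2 * ?D" using chart_denom_simplex[OF s] by (simp add: sum_distrib_left)
  also have "\<dots> = 2 * chart n a 0" unfolding chart_def chart_dir_def using D by (simp add: power2_eq_square)
  finally show ?thesis unfolding sphere_equation_iff .
qed

text \<open>Equal charts have positively proportional directions, with some ratio \<open>l\<close>;
  so minima and differences scale by \<open>l\<close>. Comparing at an index where one of the points
  attains its minimum gives \<open>b 0 = l * a 0\<close>, hence \<open>b = l * a\<close>, and the
  normalization forces \<open>l = 1\<close>.\<close>

lemma chart_inj:
  assumes a: "\<And>j. j \<le> n \<Longrightarrow> 0 \<le> a j" "(\<Sum>j\<le>n. a j) = 1" "0 < min_coord n a"
    and b: "\<And>j. j \<le> n \<Longrightarrow> 0 \<le> b j" "(\<Sum>j\<le>n. b j) = 1" "0 < min_coord n b"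
    and eq: "\<And>j. j \<le> n \<Longrightarrow> chart n a j = chart n b j" and j: "j \<le> n"
  shows "a j = b j"
proof -
  define A where "A = min_coord n a / chart_denom n a"
  define B where "B = min_coord n b / chart_denom n b"
  have A: "0 < A" and B: "0 < B" using a b chart_denom_pos[of n a] chart_denom_pos[of n b] unfolding A_def B_def by auto
  define l where "l = A / B"
  have l: "0 < l" using A B unfolding l_def by simp
  have dir: "chart_dir n b j = l * chart_dir n a j" if "j \<le> n" for j
  proof -
    have "A * chart_dir n a j = B * chart_dir n b j"
      using eq[OF that] unfolding chart_def A_def B_def by simp
    then show ?thesis unfolding l_def using B by (simp add: field_simps)
  qed
  have m: "min_coord n b = l * min_coord n a" using dir[of 0] unfolding chart_dir_def by simp
  have diff: "b j - b 0 = l * (a j - a 0)" if "j \<le> n" for j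
    using dir[OF that] unfolding chart_dir_def by (cases "j = 0") auto
  obtain k where k: "k \<le> n" "a k = min_coord n a" using min_coord_attained by blast
  obtain i where i: "i \<le> n" "b i = min_coord n b" using min_coord_attained by blast
  have "l * min_coord n a \<le> b k" using min_coord_le[OF k(1), of b] m by simp
  then have "l * a 0 \<le> b 0" using diff[OF k(1)] k(2) by (simp add: algebra_simps)
  moreover have "l * min_coord n a \<le> l * a i" using min_coord_le[OF i(1), of a] l by simp
  then have "b 0 \<le> l * a 0" using diff[OF i(1)] i(2) m by (simp add: algebra_simps)
  ultimately have b0: "b 0 = l * a 0" by simp
  have bj: "b j = l * a j" if "j \<le> n" for j using diff[OF that] b0 by (simp add: algebra_simps)
  have "(\<Sum>j\<le>n. b j) = l * (\<Sum>j\<le>n. a j)" using bj by (simp add: sum_distrib_left)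
  then have "l = 1" using a(2) b(2) by simp
  then show ?thesis using bj[OF j] by simp
qed

lemma chart_surj:
  assumes x: "(x 0 - 1)\<^sup>2 + (\<Sum>j\<in>{1..n}. (x j)\<^sup>2) = 1" and x0: "x 0 \<noteq> 0"
  obtains a where "\<And>j. j \<le> n \<Longrightarrow> 0 < a j" "(\<Sum>j\<le>n. a j) = 1" "\<And>j. j \<le> n \<Longrightarrow> chart n a j = x j"
proof -
  have sq: "(\<Sum>j\<le>n. (x j)\<^sup>2) = 2 * x 0" using x unfolding sphere_equation_iff .
  have "0 \<le> (\<Sum>j\<le>n. (x j)\<^sup>2)" by (intro sum_nonneg) auto
  then have pos: "0 < x 0" using sq x0 by simp
  define y where "y j = (if j = 0 then 0 else x j)" for j
  \<comment> \<open>Chosen so that the differences \<open>c j - c 0\<close> are the given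
    \<open>x j\<close> and the minimum is \<open>2 * x 0\<close>; the direction is then proportional
    to \<open>x\<close>, and \<open>\<sigma>\<close> only normalizes.\<close>
  define c where "c j = 2 * x 0 - min_coord n y + y j" for j
  define \<sigma> where "\<sigma> = (\<Sum>j\<le>n. c j)"
  define a where "a j = c j / \<sigma>" for j
  have c: "2 * x 0 \<le> c j" if "j \<le> n" for j unfolding c_def using min_coord_le[OF that, of y] by simp
  obtain k where k: "k \<le> n" "y k = min_coord n y" using min_coord_attained by blast
  have ck: "c k = 2 * x 0" unfolding c_def using k by simp
  have \<sigma>: "0 < \<sigma>" unfolding \<sigma>_def
  proof (rule sum_pos)
    show "0 < c j" if "j \<in> {..n}" for j using c[of j] pos that by simp
  qed auto
  have m: "min_coord n a = 2 * x 0 / \<sigma>"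
  proof (rule min_coord_eqI[OF _ k(1)])
    show "2 * x 0 / \<sigma> \<le> a j" if "j \<le> n" for j
      unfolding a_def using c[OF that] \<sigma> by (simp add: divide_right_mono)
  qed (simp add: a_def ck)
  have dir: "chart_dir n a j = x j / \<sigma>" if "j \<le> n" for j
    unfolding chart_dir_def m by (simp add: a_def c_def y_def diff_divide_distrib[symmetric])
  have s: "(\<Sum>j\<le>n. a j) = 1"
    unfolding a_def using \<sigma> by (simp add: sum_divide_distrib[symmetric] \<sigma>_def[symmetric])
  have "chart_denom n a = (\<Sum>j\<le>n. (x j)\<^sup>2 / \<sigma>\<^sup>2)"
    unfolding chart_denom_simplex[OF s] using dir by (simp add: power_divide)
  also have "\<dots> = 2 * x 0 / \<sigma>\<^sup>2" using sq by (simp add: sum_divide_distrib[symmetric])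
  finally have D: "chart_denom n a = 2 * x 0 / \<sigma>\<^sup>2" .
  show ?thesis
  proof (rule that[OF _ s])
    show "0 < a j" if "j \<le> n" for j unfolding a_def using c[OF that] pos \<sigma> by simp
    show "chart n a j = x j" if "j \<le> n" for j
      unfolding chart_def m D dir[OF that] using pos \<sigma> by (simp add: power2_eq_square)
  qed
qed


section \<open>Coordinates on a wedge of spheres and the quotient map onto it\<close>

lemma topspace_wedge_of_spheres:
  "topspace (wedge_of_spheres ns) = insert (\<lambda>_. 0) (\<Union>i < length ns.
        {x. (\<forall>p. p \<notin> {i} \<times> {0..ns ! i} \<longrightarrow> x p = 0) \<and>
            (x (i, 0) - 1)\<^sup>2 + (\<Sum>j \<in> {1..ns ! i}. (x (i, j))\<^sup>2) = 1})"
  unfolding wedge_of_spheres_def by simp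

lemma continuous_map_into_wedge_of_spheres:
  "continuous_map X (wedge_of_spheres ns) f \<longleftrightarrow>
     f \<in> topspace X \<rightarrow> topspace (wedge_of_spheres ns) \<and> (\<forall>k. continuous_map X euclideanreal (\<lambda>x. f x k))"
  unfolding topspace_wedge_of_spheres unfolding wedge_of_spheres_def
  by (auto simp: continuous_map_in_subtopology continuous_map_componentwise_UNIV)

lemma continuous_map_wedge_coordinate:
  "continuous_map (wedge_of_spheres ns) euclideanreal (\<lambda>x. x k)"
  unfolding wedge_of_spheres_def
  by (intro continuous_map_from_subtopology continuous_map_product_projection) auto

lemma Hausdorff_wedge_of_spheres: "Hausdorff_space (wedge_of_spheres ns)"
  unfolding wedge_of_spheres_def
  by (intro Hausdorff_space_subtopology) (simp add: Hausdorff_space_product_topology)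

text \<open>The map \<open>q\<close> sends the subcomplex to the origin and each open facet
  bijectively onto its sphere without the origin. Being a continuous surjection from a compact space
  to a Hausdorff space, it is a quotient map, and the extended contraction shows that the homotopy
  type is preserved.\<close>

lemma (in facet_family) homotopy_equivalent_wedge_of_spheres:
  assumes contr: "contractible_space (realization V (K - \<Phi>))"
    and ne: "topspace (realization V (K - \<Phi>)) \<noteq> {}"
  obtains fs where "set fs = \<Phi>"
    "realization V K homotopy_equivalent_space wedge_of_spheres (map (\<lambda>f. card f - 1) fs)"
proof -
  obtain fs where fs: "set fs = \<Phi>" "distinct fs" using finite_distinct_list[OF finite_facets] by blast
  let ?X = "realization V K" and ?L = "realization V (K - \<Phi>)"
  define ns where "ns = map (\<lambda>f. card f - 1) fs"
  define m where "m = length fs"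
  have len: "length ns = m" unfolding ns_def m_def by simp
  have fi: "fs ! i \<in> \<Phi>" if "i < m" for i using that fs(1) unfolding m_def by auto
  have "\<exists>e. bij_betw e {..ns ! i} (fs ! i)" if i: "i < m" for i
  proof -
    obtain e where "bij_betw e {0..<card (fs ! i)} (fs ! i)"
      using ex_bij_betw_nat_finite[OF finite_facet[OF fi[OF i]]] by blast
    moreover have "{0..<card (fs ! i)} = {..ns ! i}"
      using that card_facet_pos[OF fi[OF that]] unfolding ns_def m_def by auto
    ultimately show ?thesis by auto
  qed
  then have "\<exists>e. \<forall>i. i < m \<longrightarrow> bij_betw (e i) {..ns ! i} (fs ! i)"
    by (intro choice) blast
  then obtain e where e: "\<And>i. i < m \<Longrightarrow> bij_betw (e i) {..ns ! i} (fs ! i)" by blast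
  have eimg: "e i ` {..ns ! i} = fs ! i" if "i < m" for i using e[OF that] by (rule bij_betw_imp_surj_on)
  have eV: "e i j \<in> V" "e i j \<in> fs ! i" if "i < m" "j \<le> ns ! i" for i j
    using eimg[OF that(1)] facet_subset[OF fi[OF that(1)]] that(2) by auto
  define r where "r p i = (\<lambda>j. p (e i j))" for p :: "'a \<Rightarrow> real" and i
  \<comment> \<open>Block \<open>i\<close> vanishes wherever the weight of \<open>fs ! i\<close>
    does, so the same formula serves on and off the open facets and is continuous.\<close>
  define q where "q p = (\<lambda>(i, j). if i < m \<and> j \<le> ns ! i then chart (ns ! i) (r p i) j else 0)" for p
  have mw: "min_coord (ns ! i) (r p i) = weight p (fs ! i)" if "i < m" for p i
  proof -
    have "r p i ` {..ns ! i} = p ` (fs ! i)" unfolding r_def eimg[OF that, symmetric] by (simp add: image_image)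
    then show ?thesis unfolding min_coord_def weight_def by simp
  qed
  have rnn: "0 \<le> r p i j" if "p \<in> topspace ?X" "i < m" "j \<le> ns ! i" for p i j
    unfolding r_def using realization_nonneg[OF that(1) eV(1)[OF that(2,3)]] .
  have rsum: "(\<Sum>j\<le>ns ! i. r p i j) = sum p (fs ! i)" if "i < m" for p i
    unfolding r_def using sum.reindex_bij_betw[OF e[OF that], of p] .
  have rsum1: "(\<Sum>j\<le>ns ! i. r p i j) = 1"
    if p: "p \<in> topspace ?X" and i: "i < m" "weight p (fs ! i) \<noteq> 0" for p i
  proof -
    have "sum p (fs ! i) = sum p V"
      using V support_eq_facet[OF p fi[OF i(1)] i(2)] by (intro sum.mono_neutral_left) auto
    then show ?thesis using rsum[OF i(1)] p unfolding topspace_realization by auto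
  qed
  have q0: "q p (i, j) = 0" if "i < m \<Longrightarrow> weight p (fs ! i) = 0" for p i j
    unfolding q_def using that chart_eq_0[of "ns ! i" "r p i" j] mw[of i p] by auto
  have qL: "q p = (\<lambda>_. 0)" if "p \<in> topspace ?L" for p
  proof
    fix k :: "nat \<times> nat"
    show "q p k = 0" using that q0[of "fst k" p "snd k"] fi unfolding topspace_realization_Diff by auto
  qed
  have wpos: "0 < min_coord (ns ! i) (r p i)" if "p \<in> topspace ?X" "i < m" "weight p (fs ! i) \<noteq> 0" for p i
    using weight_nonneg[OF that(1) fi[OF that(2)]] mw[OF that(2), of p] that(3) by auto
  have exi: "\<exists>i<m. weight p (fs ! i) \<noteq> 0" if p: "p \<in> topspace ?X" "p \<notin> topspace ?L" for p
  proof -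
    obtain f where "f \<in> \<Phi>" "weight p f \<noteq> 0" using p unfolding topspace_realization_Diff by auto
    then show ?thesis using fs(1) unfolding m_def by (metis in_set_conv_nth)
  qed
  have other: "weight p (fs ! i') = 0"
    if "p \<in> topspace ?X" "i < m" "weight p (fs ! i) \<noteq> 0" "i' < m" "i' \<noteq> i" for p i i'
  proof -
    have "fs ! i' \<noteq> fs ! i" using fs(2) that unfolding m_def by (simp add: nth_eq_iff_index_eq)
    then show ?thesis using weight_unique[OF that(1) fi[OF that(2)] that(3) fi[OF that(4)]] by simp
  qed
  have qi: "q p (i, j) = chart (ns ! i) (r p i) j" if "i < m" "j \<le> ns ! i" for p i j
    unfolding q_def using that by simp
  have qW: "q p \<in> topspace (wedge_of_spheres ns)" if p: "p \<in> topspace ?X" for p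
  proof (cases "p \<in> topspace ?L")
    case True
    then show ?thesis using qL unfolding topspace_wedge_of_spheres by simp
  next
    case False
    then obtain i where i: "i < m" "weight p (fs ! i) \<noteq> 0" using exi p by blast
    have "q p k = 0" if "k \<notin> {i} \<times> {0..ns ! i}" for k
    proof (cases "fst k = i")
      case True
      then have "\<not> snd k \<le> ns ! i" using that by (cases k) auto
      then show ?thesis unfolding q_def using True by (cases k) auto
    next
      case False
      then show ?thesis using q0[of "fst k" p "snd k"] other[OF p i] by simp
    qed
    moreover have "(q p (i, 0) - 1)\<^sup>2 + (\<Sum>j \<in> {1..ns ! i}. (q p (i, j))\<^sup>2) = 1"
    proof -
      have "(\<Sum>j \<in> {1..ns ! i}. (q p (i, j))\<^sup>2) = (\<Sum>j \<in> {1..ns ! i}. (chart (ns ! i) (r p i) j)\<^sup>2)"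
        using qi[OF i(1)] by (intro sum.cong) auto
      then show ?thesis
        using chart_on_sphere[of "ns ! i" "r p i"] rnn[OF p i(1)] rsum1[OF p i] qi[OF i(1), of 0 p] by simp
    qed
    ultimately show ?thesis using i(1) len unfolding topspace_wedge_of_spheres by blast
  qed
  have cq: "continuous_map ?X (wedge_of_spheres ns) q"
    unfolding continuous_map_into_wedge_of_spheres
  proof (intro conjI allI)
    show "q \<in> topspace ?X \<rightarrow> topspace (wedge_of_spheres ns)" using qW by auto
    fix k :: "nat \<times> nat"
    obtain i j where k: "k = (i, j)" by (cases k)
    show "continuous_map ?X euclideanreal (\<lambda>x. q x k)"
    proof (cases "i < m \<and> j \<le> ns ! i")
      case True
      have cr: "continuous_map ?X euclideanreal (\<lambda>p. r p i j')" if "j' \<le> ns ! i" for j'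
        unfolding r_def by (rule continuous_map_realization_coordinate) (use eV(1) True that in simp)
      have cm: "continuous_map ?X euclideanreal (\<lambda>p. min_coord (ns ! i) (r p i))"
        using mw continuous_map_weight[OF fi] True by simp
      have cd: "continuous_map ?X euclideanreal (\<lambda>p. chart_dir (ns ! i) (r p i) j')" if "j' \<le> ns ! i" for j'
      proof (cases "j' = 0")
        case True
        then show ?thesis unfolding chart_dir_def by (auto intro!: continuous_intros cm)
      next
        case False
        then show ?thesis unfolding chart_dir_def using that by (auto intro!: continuous_intros cr)
      qed
      have cD: "continuous_map ?X euclideanreal (\<lambda>p. chart_denom (ns ! i) (r p i))"
        unfolding chart_denom_def by (intro continuous_intros cd cr) auto
      have "continuous_map ?X euclideanreal (\<lambda>p. chart (ns ! i) (r p i) j)"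
        unfolding chart_def
      proof (intro continuous_intros cm cd cD)
        show "j \<le> ns ! i" using True by simp
        show "chart_denom (ns ! i) (r p i) \<noteq> 0" if "p \<in> topspace ?X" for p
          using chart_denom_pos[of "ns ! i" "r p i"] rnn[OF that] True by force
      qed
      then show ?thesis using qi True k by simp
    next
      case False
      then show ?thesis unfolding q_def k by auto
    qed
  qed
  have surj: "q ` topspace ?X = topspace (wedge_of_spheres ns)"
  proof
    show "q ` topspace ?X \<subseteq> topspace (wedge_of_spheres ns)" using qW by auto
    show "topspace (wedge_of_spheres ns) \<subseteq> q ` topspace ?X"
    proof
      fix x assume x: "x \<in> topspace (wedge_of_spheres ns)"
      show "x \<in> q ` topspace ?X"
      proof (cases "x = (\<lambda>_. 0)")
        case True
        obtain p where p: "p \<in> topspace ?L" using ne by blast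
        then have "p \<in> topspace ?X" unfolding topspace_realization_Diff by auto
        then show ?thesis using qL[OF p] True by (metis imageI)
      next
        case False
        then obtain i where i: "i < m" and x1: "\<And>p. p \<notin> {i} \<times> {0..ns ! i} \<Longrightarrow> x p = 0"
          and x2: "(x (i, 0) - 1)\<^sup>2 + (\<Sum>j \<in> {1..ns ! i}. (x (i, j))\<^sup>2) = 1"
          using x len unfolding topspace_wedge_of_spheres by auto
        have x0: "x (i, 0) \<noteq> 0"
        proof
          assume z: "x (i, 0) = 0"
          then have "(\<Sum>j\<le>ns ! i. (x (i, j))\<^sup>2) = 0"
            using x2 sphere_equation_iff[of "\<lambda>j. x (i, j)" "ns ! i"] by simp
          then have "x (i, j) = 0" if "j \<le> ns ! i" for j using that by (simp add: sum_nonneg_eq_0_iff)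
          then have "x p = 0" for p using x1[of p] by (cases p) auto
          then show False using False by auto
        qed
        obtain a where a: "\<And>j. j \<le> ns ! i \<Longrightarrow> 0 < a j" "(\<Sum>j\<le>ns ! i. a j) = 1"
            "\<And>j. j \<le> ns ! i \<Longrightarrow> chart (ns ! i) a j = x (i, j)"
          using chart_surj[of "\<lambda>j. x (i, j)" "ns ! i"] x2 x0 by auto
        define idx where "idx = the_inv_into {..ns ! i} (e i)"
        have idx: "idx (e i j) = j" if "j \<le> ns ! i" for j
          unfolding idx_def using the_inv_into_f_f[OF bij_betw_imp_inj_on[OF e[OF i]]] that by simp
        define p where "p = restrict (\<lambda>v. if v \<in> fs ! i then a (idx v) else 0) V"
        have pe: "p (e i j) = a j" if "j \<le> ns ! i" for j unfolding p_def using eV[OF i that] idx[OF that] by simp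
        have fV: "fs ! i \<subseteq> V" using facet_subset fi[OF i] by simp
        have pz: "p v = 0" if "v \<in> V" "v \<notin> fs ! i" for v unfolding p_def using that by simp
        have pp: "0 < p v" if v: "v \<in> fs ! i" for v
        proof -
          obtain j where "j \<le> ns ! i" "v = e i j" using v eimg[OF i] by (metis atMost_iff imageE)
          then show ?thesis using pe a(1) by simp
        qed
        have ra: "r p i j = a j" if "j \<le> ns ! i" for j unfolding r_def using pe[OF that] .
        have "sum p V = sum p (fs ! i)" using V fV pz by (intro sum.mono_neutral_right) auto
        also have "\<dots> = 1" using rsum[OF i, of p] a(2) ra by simp
        finally have s1: "sum p V = 1" .
        have supp: "{v \<in> V. p v \<noteq> 0} = fs ! i" using fV pz pp by force
        have pX: "p \<in> topspace ?X"
          unfolding topspace_realization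
        proof (intro CollectI conjI ballI)
          show "p \<in> extensional V" unfolding p_def by simp
          show "0 \<le> p v" if "v \<in> V" for v using pp[of v] pz[OF that] by fastforce
          show "{v \<in> V. p v \<noteq> 0} \<in> K" using supp fi[OF i] \<Phi>K by auto
        qed (rule s1)
        have w: "weight p (fs ! i) \<noteq> 0" using weight_attained[OF fi[OF i], of p] pp by force
        have cong: "chart (ns ! i) (r p i) j = chart (ns ! i) a j" if "j \<le> ns ! i" for j
        proof -
          have "min_coord (ns ! i) (r p i) = min_coord (ns ! i) a"
            unfolding min_coord_def using ra by (intro arg_cong[of _ _ Min] image_cong) auto
          moreover from this have "chart_dir (ns ! i) (r p i) j' = chart_dir (ns ! i) a j'" if "j' \<le> ns ! i" for j'
            unfolding chart_dir_def using ra that by simp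
          ultimately show ?thesis unfolding chart_def chart_denom_def using ra that by simp
        qed
        have "q p k = x k" for k
        proof (cases "k \<in> {i} \<times> {0..ns ! i}")
          case True
          then obtain j where "k = (i, j)" "j \<le> ns ! i" by auto
          then show ?thesis using qi[OF i] cong a(3) by simp
        next
          case False
          then have "q p k = 0"
          proof (cases "fst k = i")
            case True
            then have "\<not> snd k \<le> ns ! i" using False by (cases k) auto
            then show ?thesis unfolding q_def using True by (cases k) auto
          next
            case False
            then show ?thesis using q0[of "fst k" p "snd k"] other[OF pX i w] by simp
          qed
          then show ?thesis using x1[OF False] by simp
        qed
        then have "q p = x" by auto
        then show ?thesis using pX by blast
      qed
    qed
  qed
  have nz: "q p (i, 0) \<noteq> 0" if "p \<in> topspace ?X" "i < m" "weight p (fs ! i) \<noteq> 0" for p i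
    using chart_0_pos[of "ns ! i" "r p i"] rnn[OF that(1,2)] wpos[OF that] qi[OF that(2), of 0 p] by simp
  have inj: "x = y \<or> x \<in> topspace ?L \<and> y \<in> topspace ?L"
    if x: "x \<in> topspace ?X" and y: "y \<in> topspace ?X" and eq: "q x = q y" for x y
  proof -
    \<comment> \<open>The coordinate \<open>(i, 0)\<close> of \<open>q\<close> is nonzero exactly on
      the open facet \<open>fs ! i\<close>, so equal images lie in the same open facet and
      \<open>chart_inj\<close> applies.\<close>
    have wiff: "weight x (fs ! i) \<noteq> 0 \<longleftrightarrow> weight y (fs ! i) \<noteq> 0" if "i < m" for i
      using nz[OF x that] nz[OF y that] q0[of i x 0] q0[of i y 0] eq that by metis
    show ?thesis
    proof (cases "x \<in> topspace ?L \<and> y \<in> topspace ?L")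
      case False
      then obtain i where i: "i < m" "weight x (fs ! i) \<noteq> 0" using exi x y wiff by blast
      then have i': "weight y (fs ! i) \<noteq> 0" using wiff by simp
      have r: "r x i j = r y i j" if "j \<le> ns ! i" for j
      proof (rule chart_inj[where n = "ns ! i", OF _ _ _ _ _ _ _ that])
        show "chart (ns ! i) (r x i) j' = chart (ns ! i) (r y i) j'" if "j' \<le> ns ! i" for j'
          using qi[OF i(1) that, of x] qi[OF i(1) that, of y] eq by simp
      qed (use rnn x y i i' rsum1 wpos in auto)
      have "x v = y v" if v: "v \<in> V" for v
      proof (cases "v \<in> fs ! i")
        case True
        then obtain j where "j \<le> ns ! i" "v = e i j" using eimg[OF i(1)] by (metis atMost_iff imageE)
        then show ?thesis using r unfolding r_def by simp
      next
        case False
        then have "x v = 0" "y v = 0"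
          using support_eq_facet[OF x fi[OF i(1)] i(2)] support_eq_facet[OF y fi[OF i(1)] i'] v by blast+
        then show ?thesis by simp
      qed
      moreover have "x \<in> extensional V" "y \<in> extensional V" using x y unfolding topspace_realization by auto
      ultimately show ?thesis by (metis extensionalityI)
    qed auto
  qed
  have quot: "quotient_map ?X (wedge_of_spheres ns) q"
    using continuous_imp_quotient_map[OF cq compact_space_realization[OF V KV down] Hausdorff_wedge_of_spheres surj] .
  obtain c where "homotopic_with (\<lambda>x. True) ?L ?L id (\<lambda>x. c)"
    using contr unfolding contractible_space_def by blast
  then obtain h where h: "continuous_map (prod_topology (top_of_set {0..1::real}) ?L) ?L h"
      "\<And>x. h (0, x) = x" "\<And>x. h (1, x) = c"
    unfolding homotopic_with_def by auto
  obtain H where H: "continuous_map (prod_topology (top_of_set {0..1::real}) ?X) ?X H"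
    "\<And>p. p \<in> topspace ?X \<Longrightarrow> H (0, p) = p"
    "\<And>t p. t \<in> {0..1} \<Longrightarrow> p \<in> topspace ?L \<Longrightarrow> H (t, p) = h (t, p)"
    using contraction_extends[OF h(1)] h(2) by blast
  have hL: "h (t, p) \<in> topspace ?L" if "t \<in> {0..1}" "p \<in> topspace ?L" for t p
    using continuous_map_image_subset_topspace[OF h(1)] that by auto
  have "?X homotopy_equivalent_space wedge_of_spheres ns"
  proof (rule homotopy_equivalent_space_collapse[OF quot H(1,2)])
    show "topspace ?L \<subseteq> topspace ?X" unfolding topspace_realization_Diff by auto
    show "H (t, x) \<in> topspace ?L" if "t \<in> {0..1}" "x \<in> topspace ?L" for t x
      using H(3) hL that by simp
    show "H (1, x) = c" if "x \<in> topspace ?L" for x using H(3) h(3) that by simp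
  qed (use inj qL in auto)
  then show ?thesis using that[OF fs(1)] unfolding ns_def by blast
qed


section \<open>Homology of wedges of spheres\<close>

text \<open>The identity on the homology of \<open>Y\<close> factors through that of
  \<open>X\<close>.\<close>

lemma trivial_reduced_homology_group_dominated:
  assumes f: "continuous_map Y X f" and g: "continuous_map X Y g"
    and hom: "homotopic_with (\<lambda>x. True) Y Y (g \<circ> f) id"
    and triv: "trivial_group (reduced_homology_group p X)"
  shows "trivial_group (reduced_homology_group p Y)"
proof -
  let ?X = "reduced_homology_group p X" and ?Y = "reduced_homology_group p Y"
  have "c = \<one>\<^bsub>?Y\<^esub>" if c: "c \<in> carrier ?Y" for c
  proof -
    have c': "c \<in> carrier (homology_group p Y)" using c carrier_reduced_homology_group_subset by blast
    have "hom_induced p Y {} X {} f c \<in> carrier ?X" using c by (rule hom_induced_reduced)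
    then have f1: "hom_induced p Y {} X {} f c = \<one>\<^bsub>?X\<^esub>" using triv unfolding trivial_group_def by auto
    have "c = hom_induced p Y {} Y {} id c" using hom_induced_id[OF c'] by simp
    also have "\<dots> = hom_induced p Y {} Y {} (g \<circ> f) c" using homology_homotopy_empty[OF hom] by simp
    also have "\<dots> = hom_induced p X {} Y {} g (hom_induced p Y {} X {} f c)"
      using hom_induced_compose_empty[OF f g] by simp
    also have "\<dots> = \<one>\<^bsub>?Y\<^esub>"
      unfolding f1 using hom_one[OF hom_induced_reduced_hom] by simp
    finally show ?thesis .
  qed
  then have "carrier ?Y \<subseteq> {\<one>\<^bsub>?Y\<^esub>}" by blast
  then show ?thesis using group.trivial_group_alt[OF group_reduced_homology_group] by blast
qed

lemma trivial_reduced_homology_group_pair: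
  assumes S: "trivial_group (reduced_homology_group p (subtopology X S))"
    and X: "trivial_group (relative_homology_group p X S)"
  shows "trivial_group (reduced_homology_group p X)"
proof -
  let ?G1 = "relative_homology_group p X S" and ?G2 = "reduced_homology_group p X"
    and ?G3 = "reduced_homology_group p (subtopology X S)"
  let ?h1 = "hom_induced p X {} X S id" and ?h2 = "hom_induced p (subtopology X S) {} X {} id"
  have ex: "?h2 ` carrier ?G3 = kernel ?G2 ?G1 ?h1" and gh: "group_hom ?G2 ?G1 ?h1"
    using homology_exactness_reduced_3[of p X S] by (simp_all add: group_hom_def group_hom_axioms_def)
  have "kernel ?G2 ?G1 ?h1 = carrier ?G2" using gh X by (rule group_hom.kernel_to_trivial_group)
  moreover have "?h2 ` carrier ?G3 = {\<one>\<^bsub>?G2\<^esub>}"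
    using S hom_one[OF hom_induced_reduced_hom[of p "subtopology X S" X id]] unfolding trivial_group_def by simp
  ultimately show ?thesis using ex unfolding trivial_group_def by simp
qed

text \<open>A description in which all blocks appear alike: a zero block satisfies its sphere
  equation too, since the sphere passes through the origin. Maps that act blockwise are easy to
  check against it.\<close>

lemma mem_wedge_of_spheres_iff:
  "x \<in> topspace (wedge_of_spheres ms) \<longleftrightarrow>
     (\<forall>i k. (i < length ms \<longrightarrow> ms ! i < k) \<longrightarrow> x (i, k) = 0)
   \<and> (\<forall>i<length ms. (x (i, 0) - 1)\<^sup>2 + (\<Sum>k\<in>{1..ms ! i}. (x (i, k))\<^sup>2) = 1)
   \<and> (\<forall>i i'. i \<noteq> i' \<longrightarrow> (\<forall>k. x (i, k) = 0) \<or> (\<forall>k. x (i', k) = 0))" (is "_ \<longleftrightarrow> ?R")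
proof
  assume x: "x \<in> topspace (wedge_of_spheres ms)"
  show ?R
  proof (cases "x = (\<lambda>_. 0)")
    case True
    then show ?thesis by simp
  next
    case False
    then obtain j where j: "j < length ms" and z: "\<And>p. p \<notin> {j} \<times> {0..ms ! j} \<Longrightarrow> x p = 0"
      and e: "(x (j, 0) - 1)\<^sup>2 + (\<Sum>k\<in>{1..ms ! j}. (x (j, k))\<^sup>2) = 1"
      using x unfolding topspace_wedge_of_spheres by auto
    have z': "x (i, k) = 0" if "i \<noteq> j" for i k using z that by auto
    show ?thesis
    proof (intro conjI allI impI)
      show "x (i, k) = 0" if "i < length ms \<longrightarrow> ms ! i < k" for i k
        using z[of "(i, k)"] j that by (cases "i = j") auto
      show "(x (i, 0) - 1)\<^sup>2 + (\<Sum>k\<in>{1..ms ! i}. (x (i, k))\<^sup>2) = 1" for i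
        using e z'[of i] by (cases "i = j") auto
      show "(\<forall>k. x (i, k) = 0) \<or> (\<forall>k. x (i', k) = 0)" if "i \<noteq> i'" for i i'
        using z' that by (cases "i = j") auto
    qed
  qed
next
  assume R: ?R
  show "x \<in> topspace (wedge_of_spheres ms)"
  proof (cases "x = (\<lambda>_. 0)")
    case True
    then show ?thesis unfolding topspace_wedge_of_spheres by simp
  next
    case False
    then obtain j k where jk: "x (j, k) \<noteq> 0" by (auto simp: fun_eq_iff)
    then have j: "j < length ms" using R by blast
    have "x p = 0" if p: "p \<notin> {j} \<times> {0..ms ! j}" for p
    proof (cases "fst p = j")
      case True
      then have "ms ! j < snd p" using p by (cases p) auto
      then show ?thesis using R True by (metis prod.collapse)
    next
      case False
      then have "x (fst p, snd p) = 0" using R jk by metis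
      then show ?thesis by simp
    qed
    then show ?thesis using R j unfolding topspace_wedge_of_spheres by blast
  qed
qed

text \<open>Translation by the centre of sphere \<open>i\<close>. The points of the other spheres
  have a zero block here and go to the image of the base point.\<close>

definition sphere_proj :: "nat \<Rightarrow> nat \<Rightarrow> (nat \<times> nat \<Rightarrow> real) \<Rightarrow> nat \<Rightarrow> real" where
  "sphere_proj i n x = (\<lambda>k. if k \<le> n then x (i, k) - (if k = 0 then 1 else 0) else 0)"

definition sphere_emb :: "nat \<Rightarrow> nat \<Rightarrow> (nat \<Rightarrow> real) \<Rightarrow> nat \<times> nat \<Rightarrow> real" where
  "sphere_emb i n y = (\<lambda>(i', k). if i' = i \<and> k \<le> n then y k + (if k = 0 then 1 else 0) else 0)"

lemma sum_atMost_shift: "(\<Sum>k\<le>n. f k) = f 0 + (\<Sum>k\<in>{1..n}. f (k::nat))" for f :: "nat \<Rightarrow> real"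
proof -
  have "{..n} = insert 0 {1..n}" by auto
  then show ?thesis by simp
qed

lemma mem_nsphere_iff: "y \<in> topspace (nsphere n) \<longleftrightarrow> (\<Sum>i\<le>n. (y i)\<^sup>2) = 1 \<and> (\<forall>i>n. y i = 0)"
  by (simp add: nsphere)

lemma continuous_map_into_nsphere:
  "continuous_map X (nsphere n) f \<longleftrightarrow>
     f \<in> topspace X \<rightarrow> topspace (nsphere n) \<and> (\<forall>k. continuous_map X euclideanreal (\<lambda>x. f x k))"
  by (auto simp: nsphere continuous_map_in_subtopology continuous_map_componentwise_UNIV)

lemma continuous_map_sphere_proj:
  assumes i: "i < length ms"
  shows "continuous_map (wedge_of_spheres ms) (nsphere (ms ! i)) (sphere_proj i (ms ! i))"
  unfolding continuous_map_into_nsphere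
proof (intro conjI allI)
  show "sphere_proj i (ms ! i) \<in> topspace (wedge_of_spheres ms) \<rightarrow> topspace (nsphere (ms ! i))"
  proof
    fix x assume "x \<in> topspace (wedge_of_spheres ms)"
    then have "(x (i, 0) - 1)\<^sup>2 + (\<Sum>k\<in>{1..ms ! i}. (x (i, k))\<^sup>2) = 1"
      using i unfolding mem_wedge_of_spheres_iff by simp
    then show "sphere_proj i (ms ! i) x \<in> topspace (nsphere (ms ! i))"
      unfolding mem_nsphere_iff sphere_proj_def by (simp add: sum_atMost_shift)
  qed
  show "continuous_map (wedge_of_spheres ms) euclideanreal (\<lambda>x. sphere_proj i (ms ! i) x k)" for k
    unfolding sphere_proj_def by (cases "k \<le> ms ! i"; cases "k = 0")
      (auto intro!: continuous_intros continuous_map_wedge_coordinate)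
qed

lemma continuous_map_sphere_emb:
  assumes i: "i < length ms"
  shows "continuous_map (nsphere (ms ! i)) (wedge_of_spheres ms) (sphere_emb i (ms ! i))"
  unfolding continuous_map_into_wedge_of_spheres
proof (intro conjI allI)
  show "sphere_emb i (ms ! i) \<in> topspace (nsphere (ms ! i)) \<rightarrow> topspace (wedge_of_spheres ms)"
  proof
    fix y assume "y \<in> topspace (nsphere (ms ! i))"
    then have "(\<Sum>k\<le>ms ! i. (y k)\<^sup>2) = 1" unfolding mem_nsphere_iff by simp
    then show "sphere_emb i (ms ! i) y \<in> topspace (wedge_of_spheres ms)"
      unfolding mem_wedge_of_spheres_iff sphere_emb_def using i by (auto simp: sum_atMost_shift)
  qed
  fix p :: "nat \<times> nat"
  obtain i' k where p: "p = (i', k)" by (cases p)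
  have "continuous_map (nsphere (ms ! i)) euclideanreal (\<lambda>y. y k)"
    unfolding nsphere by (intro continuous_map_from_subtopology continuous_map_product_projection) auto
  then show "continuous_map (nsphere (ms ! i)) euclideanreal (\<lambda>x. sphere_emb i (ms ! i) x p)"
    unfolding sphere_emb_def p by (cases "i' = i \<and> k \<le> ms ! i"; cases "k = 0") (auto intro!: continuous_intros)
qed

lemma sphere_proj_emb: "y \<in> topspace (nsphere n) \<Longrightarrow> sphere_proj i n (sphere_emb i n y) = y"
  unfolding mem_nsphere_iff sphere_proj_def sphere_emb_def by auto

text \<open>Each sphere is a retract of the wedge, so its homology is a direct obstruction.\<close>

lemma nontrivial_reduced_homology_wedge_of_spheres:
  assumes "n \<in> set ns"
  shows "\<not> trivial_group (reduced_homology_group (int n) (wedge_of_spheres ns))"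
proof
  assume triv: "trivial_group (reduced_homology_group (int n) (wedge_of_spheres ns))"
  obtain i where i: "i < length ns" "ns ! i = n" using assms by (metis in_set_conv_nth)
  note emb = continuous_map_sphere_emb[OF i(1), unfolded i(2)]
  note proj = continuous_map_sphere_proj[OF i(1), unfolded i(2)]
  have "homotopic_with (\<lambda>x. True) (nsphere n) (nsphere n) (sphere_proj i n \<circ> sphere_emb i n) id"
    by (rule homotopic_with_equal) (auto simp: sphere_proj_emb continuous_map_compose[OF emb proj])
  then have "trivial_group (reduced_homology_group (int n) (nsphere n))"
    by (rule trivial_reduced_homology_group_dominated[OF emb proj _ triv])
  then show False by (simp add: trivial_reduced_homology_group_nsphere)
qed

text \<open>The coordinates with \<open>k > 0\<close> are scaled, and \<open>x (i, 0)\<close> is the smaller solution of the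
  equation of the sphere.\<close>

definition shrink_caps :: "nat \<Rightarrow> real \<times> (nat \<times> nat \<Rightarrow> real) \<Rightarrow> nat \<times> nat \<Rightarrow> real" where
  "shrink_caps M = (\<lambda>(t, x) (i, k).
     if i < M then if k = 0 then 1 - sqrt (1 - (1 - t)\<^sup>2 * (1 - (x (i, 0) - 1)\<^sup>2)) else (1 - t) * x (i, k)
     else x (i, k))"

text \<open>An open neighbourhood of the spheres with index at least \<open>M\<close>: of each
  earlier sphere only the open hemisphere around the base point is kept.\<close>

definition low_caps :: "nat \<Rightarrow> nat list \<Rightarrow> (nat \<times> nat \<Rightarrow> real) set" where
  "low_caps M ms = {x \<in> topspace (wedge_of_spheres ms). \<forall>i<M. x (i, 0) < 1}"

lemma shrink_caps_low_caps:
  assumes M: "M \<le> length ms" and x: "x \<in> low_caps M ms" and t: "t \<in> {0..1}"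
  shows "shrink_caps M (t, x) \<in> low_caps M ms"
proof -
  let ?y = "shrink_caps M (t, x)"
  have xW: "x \<in> topspace (wedge_of_spheres ms)" and low: "\<And>i. i < M \<Longrightarrow> x (i, 0) < 1"
    using x unfolding low_caps_def by auto
  have t2: "(1 - t)\<^sup>2 \<le> 1" "0 \<le> (1 - t)\<^sup>2" using t by (auto simp: power_le_one)
  \<comment> \<open>Strict positivity keeps the new coordinate \<open>(i, 0)\<close> below
    1.\<close>
  have arg: "0 < 1 - (1 - t)\<^sup>2 * (1 - (x (i, 0) - 1)\<^sup>2)" if "i < M" for i
  proof -
    define c where "c = 1 - (x (i, 0) - 1)\<^sup>2"
    define s where "s = (1 - t)\<^sup>2"
    have c1: "c < 1" unfolding c_def using low[OF that] by simp
    have s: "s \<le> 1" "0 \<le> s" using t2 unfolding s_def by auto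
    have "s * c < 1"
    proof (cases "0 \<le> c")
      case True
      then have "s * c \<le> 1 * c" using s by (intro mult_right_mono) auto
      then show ?thesis using c1 by linarith
    next
      case False
      then have "s * c \<le> 0" using s by (simp add: mult_nonneg_nonpos)
      then show ?thesis by linarith
    qed
    then show ?thesis unfolding c_def s_def by linarith
  qed
  have zero: "?y (i, k) = 0" if "\<And>k. x (i, k) = 0" for i k
    using that unfolding shrink_caps_def by simp
  have "?y \<in> topspace (wedge_of_spheres ms)"
    unfolding mem_wedge_of_spheres_iff
  proof (intro conjI allI impI)
    show "?y (i, k) = 0" if ik: "i < length ms \<longrightarrow> ms ! i < k" for i k
    proof -
      have "x (i, k) = 0" using xW ik unfolding mem_wedge_of_spheres_iff by blast
      moreover have "i < M \<Longrightarrow> k \<noteq> 0" using ik M by auto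
      ultimately show ?thesis unfolding shrink_caps_def by auto
    qed
    show "(\<forall>k. ?y (i, k) = 0) \<or> (\<forall>k. ?y (i', k) = 0)" if "i \<noteq> i'" for i i'
      using xW that zero unfolding mem_wedge_of_spheres_iff by metis
    fix i assume i: "i < length ms"
    have e: "(x (i, 0) - 1)\<^sup>2 + (\<Sum>k\<in>{1..ms ! i}. (x (i, k))\<^sup>2) = 1"
      using xW i unfolding mem_wedge_of_spheres_iff by simp
    show "(?y (i, 0) - 1)\<^sup>2 + (\<Sum>k\<in>{1..ms ! i}. (?y (i, k))\<^sup>2) = 1"
    proof (cases "i < M")
      case True
      have "(\<Sum>k\<in>{1..ms ! i}. (?y (i, k))\<^sup>2) = (\<Sum>k\<in>{1..ms ! i}. (1 - t)\<^sup>2 * (x (i, k))\<^sup>2)"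
        using True unfolding shrink_caps_def by (intro sum.cong) (auto simp: power_mult_distrib)
      also have "\<dots> = (1 - t)\<^sup>2 * (1 - (x (i, 0) - 1)\<^sup>2)"
        using e by (simp add: sum_distrib_left[symmetric])
      finally have s: "(\<Sum>k\<in>{1..ms ! i}. (?y (i, k))\<^sup>2) = (1 - t)\<^sup>2 * (1 - (x (i, 0) - 1)\<^sup>2)" .
      have "(?y (i, 0) - 1)\<^sup>2 = 1 - (1 - t)\<^sup>2 * (1 - (x (i, 0) - 1)\<^sup>2)"
        using True arg[OF True] unfolding shrink_caps_def by simp
      then show ?thesis using s by simp
    next
      case False
      then show ?thesis using e unfolding shrink_caps_def by simp
    qed
  qed
  moreover have "?y (i, 0) < 1" if "i < M" for i using arg[OF that] that unfolding shrink_caps_def by simp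
  ultimately show ?thesis unfolding low_caps_def by simp
qed

lemma shrink_caps_0:
  assumes "x \<in> low_caps M ms"
  shows "shrink_caps M (0, x) = x"
proof
  fix p :: "nat \<times> nat"
  have "\<bar>x (i, 0) - 1\<bar> = 1 - x (i, 0)" if "i < M" for i using assms that unfolding low_caps_def by auto
  then show "shrink_caps M (0, x) p = x p" unfolding shrink_caps_def by (cases p) auto
qed

lemma shrink_caps_1: "shrink_caps M (1, x) (i, k) = (if i < M then 0 else x (i, k))"
  unfolding shrink_caps_def by simp

text \<open>Stated for any invariant \<open>S\<close>, because it serves both the whole
  neighbourhood and its part outside the last sphere.\<close>

lemma continuous_map_shrink_caps:
  assumes M: "M \<le> length ms" and S: "S \<subseteq> low_caps M ms"
    and closed: "\<And>t x. t \<in> {0..1} \<Longrightarrow> x \<in> S \<Longrightarrow> shrink_caps M (t, x) \<in> S"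
  shows "continuous_map (prod_topology (top_of_set {0..1}) (subtopology (wedge_of_spheres ms) S))
           (subtopology (wedge_of_spheres ms) S) (shrink_caps M)"
proof -
  let ?Z = "prod_topology (top_of_set {0..1::real}) (subtopology (wedge_of_spheres ms) S)"
  have SW: "S \<subseteq> topspace (wedge_of_spheres ms)" using S unfolding low_caps_def by auto
  have cf: "continuous_map ?Z euclideanreal fst"
    by (rule continuous_map_into_fulltopology[OF continuous_map_fst])
  have cc: "continuous_map ?Z euclideanreal (\<lambda>z. snd z p)" for p
    using continuous_map_compose[OF continuous_map_snd
        continuous_map_from_subtopology[OF continuous_map_wedge_coordinate[of ms p]]] by (simp add: o_def)
  have im: "shrink_caps M \<in> topspace ?Z \<rightarrow> S" using closed SW by auto
  have "continuous_map ?Z euclideanreal (\<lambda>z. shrink_caps M z p)" for p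
  proof -
    obtain i k where p: "p = (i, k)" by (cases p)
    consider "i < M" "k = 0" | "i < M" "k \<noteq> 0" | "\<not> i < M" by blast
    then show ?thesis
    proof cases
      case 1
      then have "(\<lambda>z. shrink_caps M z p) = (\<lambda>z. 1 - sqrt (1 - (1 - fst z)\<^sup>2 * (1 - (snd z (i, 0) - 1)\<^sup>2)))"
        unfolding p shrink_caps_def by (auto simp: case_prod_unfold)
      moreover have "continuous_map ?Z euclideanreal \<dots>" by (intro continuous_intros cf cc)
      ultimately show ?thesis by simp
    next
      case 2
      then have "(\<lambda>z. shrink_caps M z p) = (\<lambda>z. (1 - fst z) * snd z (i, k))"
        unfolding p shrink_caps_def by (auto simp: case_prod_unfold)
      moreover have "continuous_map ?Z euclideanreal \<dots>" by (intro continuous_intros cf cc)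
      ultimately show ?thesis by simp
    next
      case 3
      then have "(\<lambda>z. shrink_caps M z p) = (\<lambda>z. snd z p)"
        unfolding p shrink_caps_def by (auto simp: case_prod_unfold)
      then show ?thesis using cc by simp
    qed
  qed
  then show ?thesis
    unfolding continuous_map_in_subtopology continuous_map_into_wedge_of_spheres
    using im SW by auto
qed

lemma openin_low_caps: "openin (wedge_of_spheres ms) (low_caps M ms)"
proof (induction M)
  case 0
  then show ?case unfolding low_caps_def by simp
next
  case (Suc M)
  have "openin (wedge_of_spheres ms) {x \<in> topspace (wedge_of_spheres ms). x (M, 0) \<in> {..<1}}"
    by (rule openin_continuous_map_preimage[OF continuous_map_wedge_coordinate]) auto
  then have "openin (wedge_of_spheres ms) (low_caps M ms \<inter> {x \<in> topspace (wedge_of_spheres ms). x (M, 0) \<in> {..<1}})"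
    using Suc by (rule openin_Int[rotated])
  moreover have "low_caps M ms \<inter> {x \<in> topspace (wedge_of_spheres ms). x (M, 0) \<in> {..<1}} = low_caps (Suc M) ms"
    unfolding low_caps_def by (auto simp: less_Suc_eq)
  ultimately show ?case by simp
qed

text \<open>The hyperplane is tangent to the sphere and touches it only at the base point.\<close>

lemma wedge_coordinates_zero:
  assumes x: "x \<in> topspace (wedge_of_spheres ms)" and 0: "x (i, 0) = 0"
  shows "x (i, k) = 0"
proof (cases "i < length ms \<and> k \<in> {1..ms ! i}")
  case True
  then have "(x (i, 0) - 1)\<^sup>2 + (\<Sum>k\<in>{1..ms ! i}. (x (i, k))\<^sup>2) = 1"
    using x unfolding mem_wedge_of_spheres_iff by simp
  then have "(\<Sum>k\<in>{1..ms ! i}. (x (i, k))\<^sup>2) = 0" using 0 by simp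
  then show ?thesis using True by (simp add: sum_nonneg_eq_0_iff)
next
  case False
  show ?thesis
  proof (cases "k = 0")
    case True
    then show ?thesis using 0 by simp
  next
    case nz: False
    then have "i < length ms \<longrightarrow> ms ! i < k" using False by auto
    then show ?thesis using x unfolding mem_wedge_of_spheres_iff by blast
  qed
qed

lemma wedge_coordinates_other:
  assumes x: "x \<in> topspace (wedge_of_spheres ms)" and "x (i, k) \<noteq> 0" "i \<noteq> i'"
  shows "x (i', k') = 0"
proof -
  have "\<forall>i i'. i \<noteq> i' \<longrightarrow> (\<forall>k. x (i, k) = 0) \<or> (\<forall>k. x (i', k) = 0)"
    using x unfolding mem_wedge_of_spheres_iff by (elim conjE)
  then show ?thesis using assms(2,3) by metis
qed

text \<open>All wedges live in the same product space, so dropping the last sphere gives an equality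
  of topologies and excision can be applied directly.\<close>

lemma wedge_of_spheres_butlast:
  "wedge_of_spheres ns = subtopology (wedge_of_spheres (ns @ [n]))
     {x \<in> topspace (wedge_of_spheres (ns @ [n])). x (length ns, 0) = 0}"
proof -
  let ?M = "length ns"
  let ?B = "{x \<in> topspace (wedge_of_spheres (ns @ [n])). x (?M, 0) = 0}"
  let ?P = "powertop_real UNIV :: (nat \<times> nat \<Rightarrow> real) topology"
  have top: "topspace (wedge_of_spheres ns) = ?B"
  proof (intro Set.set_eqI iffI)
    fix x assume x: "x \<in> topspace (wedge_of_spheres ns)"
    have "x (?M, k) = 0" for k using x unfolding mem_wedge_of_spheres_iff by simp
    moreover have "x (i, k) = 0" if "i < length (ns @ [n]) \<longrightarrow> (ns @ [n]) ! i < k" for i k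
    proof -
      have "i < ?M \<longrightarrow> ns ! i < k" using that by (auto simp: nth_append)
      then show ?thesis using x unfolding mem_wedge_of_spheres_iff by blast
    qed
    ultimately show "x \<in> ?B"
      using x unfolding mem_wedge_of_spheres_iff by (auto simp: nth_append less_Suc_eq)
  next
    fix x assume x: "x \<in> ?B"
    then have z: "x (?M, k) = 0" for k using wedge_coordinates_zero by blast
    have xW: "x \<in> topspace (wedge_of_spheres (ns @ [n]))" using x by simp
    show "x \<in> topspace (wedge_of_spheres ns)"
      unfolding mem_wedge_of_spheres_iff
    proof (intro conjI allI impI)
      show "x (i, k) = 0" if ik: "i < ?M \<longrightarrow> ns ! i < k" for i k
      proof (cases "i = ?M")
        case False
        then have "i < length (ns @ [n]) \<longrightarrow> (ns @ [n]) ! i < k" using ik by (auto simp: nth_append)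
        then show ?thesis using xW unfolding mem_wedge_of_spheres_iff by blast
      qed (simp add: z)
      show "(x (i, 0) - 1)\<^sup>2 + (\<Sum>k\<in>{1..ns ! i}. (x (i, k))\<^sup>2) = 1" if "i < ?M" for i
      proof -
        have "i < length (ns @ [n])" "(ns @ [n]) ! i = ns ! i" using that by (auto simp: nth_append)
        then show ?thesis using xW unfolding mem_wedge_of_spheres_iff by metis
      qed
      show "(\<forall>k. x (i, k) = 0) \<or> (\<forall>k. x (i', k) = 0)" if "i \<noteq> i'" for i i'
        using xW that unfolding mem_wedge_of_spheres_iff by blast
    qed
  qed
  have W: "wedge_of_spheres ms = subtopology ?P (topspace (wedge_of_spheres ms))" for ms
    unfolding topspace_wedge_of_spheres unfolding wedge_of_spheres_def ..
  have "subtopology (wedge_of_spheres (ns @ [n])) ?B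
      = subtopology (subtopology ?P (topspace (wedge_of_spheres (ns @ [n])))) ?B"
    by (rule arg_cong[OF W, of "\<lambda>T. subtopology T ?B"])
  also have "\<dots> = subtopology ?P (topspace (wedge_of_spheres (ns @ [n])) \<inter> ?B)"
    by (rule subtopology_subtopology)
  also have "topspace (wedge_of_spheres (ns @ [n])) \<inter> ?B = topspace (wedge_of_spheres ns)"
    unfolding top by auto
  also have "subtopology ?P \<dots> = wedge_of_spheres ns" by (rule W[symmetric])
  finally show ?thesis by (rule sym)
qed

text \<open>A Mayer-Vietoris argument by hand. The neighbourhood \<open>?N\<close> of the last
  sphere retracts onto it; excising \<open>?U\<close>, the last sphere without the base point,
  identifies the homology of the pair with the reduced homology of the shorter wedge. Both vanish in
  degree \<open>p\<close>, and exactness finishes.\<close>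

lemma trivial_reduced_homology_wedge_of_spheres:
  assumes "p \<notin> int ` set ns"
  shows "trivial_group (reduced_homology_group p (wedge_of_spheres ns))"
  using assms
proof (induction ns rule: rev_induct)
  case Nil
  have "topspace (wedge_of_spheres []) = {\<lambda>_. 0}" unfolding topspace_wedge_of_spheres by simp
  then show ?case by (rule homology_dimension_reduced)
next
  case (snoc n ns)
  let ?M = "length ns" and ?W = "wedge_of_spheres (ns @ [n])"
  let ?N = "low_caps ?M (ns @ [n])" and ?U = "{x \<in> topspace ?W. x (?M, 0) \<noteq> 0}"
  \<comment> \<open>A closed set squeezed between \<open>?U\<close> and \<open>?N\<close>, which
    gives the closure condition for excision.\<close>
  let ?A = "{x \<in> topspace ?W. (\<Sum>i<?M. (x (i, 0))\<^sup>2) \<in> {0}}"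
  have M: "?M \<le> length (ns @ [n])" by simp
  have NW: "?N \<subseteq> topspace ?W" unfolding low_caps_def by auto
  have "closedin ?W ?A"
  proof (rule closedin_continuous_map_preimage)
    show "continuous_map ?W euclideanreal (\<lambda>x. \<Sum>i<?M. (x (i, 0))\<^sup>2)"
      by (intro continuous_intros continuous_map_wedge_coordinate) auto
  qed auto
  moreover have "?U \<subseteq> ?A"
  proof
    fix x assume x: "x \<in> ?U"
    have "x (i, 0) = 0" if "i < ?M" for i
      using wedge_coordinates_other[of x "ns @ [n]" ?M 0 i 0] x that by simp
    then show "x \<in> ?A" using x by simp
  qed
  ultimately have "?W closure_of ?U \<subseteq> ?A" by (intro closure_of_minimal)
  also have "?A \<subseteq> ?N" unfolding low_caps_def by (auto simp: sum_nonneg_eq_0_iff)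
  also have "?N = ?W interior_of ?N" using openin_low_caps by (simp add: interior_of_openin)
  finally have "hom_induced p (subtopology ?W (topspace ?W - ?U)) (?N - ?U) (subtopology ?W (topspace ?W)) ?N id
    \<in> iso (relative_homology_group p (subtopology ?W (topspace ?W - ?U)) (?N - ?U))
          (relative_homology_group p (subtopology ?W (topspace ?W)) ?N)"
    using NW by (rule homology_excision_axiom)
  moreover have "topspace ?W - ?U = {x \<in> topspace ?W. x (?M, 0) = 0}" by auto
  then have sub: "subtopology ?W (topspace ?W - ?U) = wedge_of_spheres ns"
    using wedge_of_spheres_butlast[of ns n] by simp
  ultimately have i1: "relative_homology_group p (wedge_of_spheres ns) (?N - ?U) \<cong> relative_homology_group p ?W ?N"
    by (auto simp: is_isoI)
  \<comment> \<open>What is left of the neighbourhood in the shorter wedge consists of caps only,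
    and shrinking them contracts it to the origin.\<close>
  have i2: "relative_homology_group p (wedge_of_spheres ns) (?N - ?U) \<cong> reduced_homology_group p (wedge_of_spheres ns)"
  proof (rule isomorphic_relative_homology_by_contractible)
    have eq: "subtopology (wedge_of_spheres ns) (?N - ?U) = subtopology ?W (?N - ?U)"
    proof -
      have "(topspace ?W - ?U) \<inter> (?N - ?U) = ?N - ?U" using NW by auto
      then show ?thesis unfolding sub[symmetric] subtopology_subtopology by simp
    qed
    have S: "x (?M, 0) = 0" if "x \<in> ?N - ?U" for x using that NW by auto
    have cont: "continuous_map (prod_topology (top_of_set {0..1}) (subtopology ?W (?N - ?U))) (subtopology ?W (?N - ?U)) (shrink_caps ?M)"
    proof (rule continuous_map_shrink_caps[OF M])
      fix t :: real and x assume t: "t \<in> {0..1}" and x: "x \<in> ?N - ?U"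
      have "shrink_caps ?M (t, x) (?M, 0) = 0" using S[OF x] unfolding shrink_caps_def by simp
      then show "shrink_caps ?M (t, x) \<in> ?N - ?U" using shrink_caps_low_caps[OF M _ t] x by simp
    qed auto
    have "homotopic_with (\<lambda>x. True) (subtopology ?W (?N - ?U)) (subtopology ?W (?N - ?U)) id (\<lambda>_. (\<lambda>_. 0))"
    proof (rule homotopic_withI[OF cont])
      fix x assume "x \<in> topspace (subtopology ?W (?N - ?U))"
      then have x: "x \<in> ?N - ?U" by auto
      then show "shrink_caps ?M (0, x) = id x" using shrink_caps_0[of x ?M "ns @ [n]"] by simp
      have "x (i, k) = 0" if "\<not> i < ?M" for i k
      proof (cases "i = ?M")
        case True
        then show ?thesis using wedge_coordinates_zero[of x "ns @ [n]" ?M k] S[OF x] x NW by auto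
      next
        case False
        then show ?thesis using x NW that unfolding mem_wedge_of_spheres_iff by (auto simp: low_caps_def mem_wedge_of_spheres_iff)
      qed
      then show "shrink_caps ?M (1, x) = (\<lambda>_. 0)" by (auto simp: shrink_caps_1)
    qed
    then show "contractible_space (subtopology (wedge_of_spheres ns) (?N - ?U))"
      unfolding eq contractible_space_def by blast
    have "(\<lambda>_. 0) \<in> topspace (wedge_of_spheres ns)" "(\<lambda>_. 0) \<in> topspace ?W" unfolding topspace_wedge_of_spheres by auto
    then have "(\<lambda>_. 0) \<in> topspace (wedge_of_spheres ns) \<inter> (?N - ?U)" unfolding low_caps_def by simp
    then show "topspace (wedge_of_spheres ns) \<inter> (?N - ?U) \<noteq> {}" by blast
  qed
  have "trivial_group (reduced_homology_group p (wedge_of_spheres ns))" using snoc by auto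
  then have "trivial_group (relative_homology_group p (wedge_of_spheres ns) (?N - ?U))"
    using isomorphic_group_triviality[OF i2] by simp
  then have rel: "trivial_group (relative_homology_group p ?W ?N)"
    using isomorphic_group_triviality[OF i1] by simp
  have "trivial_group (reduced_homology_group p (subtopology ?W ?N))"
  proof (rule trivial_reduced_homology_group_dominated)
    have nth: "(ns @ [n]) ! ?M = n" by simp
    show "continuous_map (subtopology ?W ?N) (nsphere n) (sphere_proj ?M n)"
      using continuous_map_sphere_proj[of ?M "ns @ [n]"] by (simp add: continuous_map_from_subtopology)
    have "continuous_map (nsphere n) ?W (sphere_emb ?M n)"
      using continuous_map_sphere_emb[of ?M "ns @ [n]"] by simp
    moreover have "sphere_emb ?M n y (i, 0) < 1" if "i < ?M" for y i
      using that unfolding sphere_emb_def by simp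
    ultimately show "continuous_map (nsphere n) (subtopology ?W ?N) (sphere_emb ?M n)"
      using continuous_map_image_subset_topspace[of "nsphere n" ?W "sphere_emb ?M n"]
      by (auto simp: continuous_map_in_subtopology low_caps_def image_subset_iff)
    have cont: "continuous_map (prod_topology (top_of_set {0..1}) (subtopology ?W ?N)) (subtopology ?W ?N) (shrink_caps ?M)"
      by (rule continuous_map_shrink_caps[OF M order_refl]) (rule shrink_caps_low_caps[OF M])
    have "homotopic_with (\<lambda>x. True) (subtopology ?W ?N) (subtopology ?W ?N) id (sphere_emb ?M n \<circ> sphere_proj ?M n)"
    proof (rule homotopic_withI[OF cont])
      fix x assume "x \<in> topspace (subtopology ?W ?N)"
      then have x: "x \<in> ?N" and xW: "x \<in> topspace ?W" by auto
      show "shrink_caps ?M (0, x) = id x" using shrink_caps_0[OF x] by simp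
      have "shrink_caps ?M (1, x) (i, k) = sphere_emb ?M n (sphere_proj ?M n x) (i, k)" for i k
      proof (cases "i = ?M \<and> k \<le> n")
        case True
        then show ?thesis unfolding shrink_caps_1 sphere_emb_def sphere_proj_def by simp
      next
        case False
        have "x (i, k) = 0" if "\<not> i < ?M"
        proof -
          have "i < length (ns @ [n]) \<longrightarrow> (ns @ [n]) ! i < k" using that False by (auto simp: less_Suc_eq)
          then show ?thesis using xW unfolding mem_wedge_of_spheres_iff by blast
        qed
        then show ?thesis using False unfolding shrink_caps_1 sphere_emb_def by auto
      qed
      then show "shrink_caps ?M (1, x) = (sphere_emb ?M n \<circ> sphere_proj ?M n) x" by auto
    qed
    then show "homotopic_with (\<lambda>x. True) (subtopology ?W ?N) (subtopology ?W ?N) (sphere_emb ?M n \<circ> sphere_proj ?M n) id"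
      by (rule homotopic_with_symD)
    show "trivial_group (reduced_homology_group p (nsphere n))"
      using snoc.prems by (simp add: trivial_reduced_homology_group_nsphere)
  qed
  then show ?case using rel by (rule trivial_reduced_homology_group_pair)
qed


section \<open>Connectivity\<close>

lemma topspace_nonempty_of_homotopy_equivalent_wedge:
  assumes "X homotopy_equivalent_space wedge_of_spheres ns"
  shows "topspace X \<noteq> {}"
proof -
  obtain g where "continuous_map (wedge_of_spheres ns) X g"
    using assms unfolding homotopy_equivalent_space_def by blast
  then have "g (\<lambda>_. 0) \<in> topspace X"
    using continuous_map_image_subset_topspace[of "wedge_of_spheres ns" X g]
    by (auto simp: topspace_wedge_of_spheres)
  then show ?thesis by auto
qed

text \<open>A wedge contains the origin, so the realization is nonempty and the convention for the
  complex \<open>{{}}\<close> does not come into play.\<close>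

lemma rhom_vanishes_wedge:
  assumes "realization V K homotopy_equivalent_space wedge_of_spheres ns"
  shows "rhom_vanishes V K i \<longleftrightarrow> i \<notin> int ` set ns"
proof -
  have "rhom_vanishes V K i \<longleftrightarrow> trivial_group (reduced_homology_group i (realization V K))"
    unfolding rhom_vanishes_def using topspace_nonempty_of_homotopy_equivalent_wedge[OF assms] by simp
  also have "\<dots> \<longleftrightarrow> trivial_group (reduced_homology_group i (wedge_of_spheres ns))"
    using homotopy_equivalent_space_imp_isomorphic_reduced_homology_groups[OF assms]
    by (rule isomorphic_group_triviality) simp_all
  also have "\<dots> \<longleftrightarrow> i \<notin> int ` set ns"
    using trivial_reduced_homology_wedge_of_spheres[of i ns] nontrivial_reduced_homology_wedge_of_spheres[of _ ns]
    by auto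
  finally show ?thesis .
qed

lemma conn_h_lower:
  assumes "\<And>i. i \<le> k \<Longrightarrow> rhom_vanishes V K i"
  shows "ereal (of_int k) \<le> conn_h V K"
  unfolding conn_h_def by (rule Sup_upper) (use assms in auto)

lemma conn_h_upper:
  assumes "\<not> rhom_vanishes V K n"
  shows "conn_h V K \<le> ereal (of_int (n - 1))"
  unfolding conn_h_def
proof (rule Sup_least)
  fix y assume "y \<in> {ereal (of_int k) | k. \<forall>i \<le> k. rhom_vanishes V K i}"
  then obtain k where k: "y = ereal (of_int k)" "\<forall>i \<le> k. rhom_vanishes V K i" by blast
  then have "\<not> n \<le> k" using assms by blast
  then have "k \<le> n - 1" by simp
  then have "(of_int k :: real) \<le> of_int (n - 1)" by (rule of_int_le_iff[THEN iffD2])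
  then show "y \<le> ereal (of_int (n - 1))" unfolding k(1) by simp
qed

lemma not_void_collapsible_empty_face: "\<not> void_collapsible {{}}"
  by (auto elim: void_collapsible.cases)

section \<open>Connectivity from a critical family\<close>

context pc_hypergraph
begin

text \<open>Edges have at least two elements, so every singleton is a face and \<open>{}\<close> is
  not maximal once \<open>A\<close> is nonempty.\<close>

lemma critical_wedge:
  assumes A: "finite A" "A \<noteq> {}" and cr: "critical A \<Phi>"
  shows "{} \<notin> \<Phi>"
    and "\<exists>fs. set fs = \<Phi> \<and> realization A (Ind A C) homotopy_equivalent_space wedge_of_spheres (map (\<lambda>f. card f - 1) fs)"
proof -
  let ?K = "Ind A C"
  have big: "\<not> E \<subseteq> {a}" if "E \<in> C" for E a
    using card_mono[of "{a}" E] card_edge[OF that] two_le_d[OF that] by auto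
  obtain a where "a \<in> A" using A by auto
  then have aK: "{a} \<in> ?K" using big unfolding Ind_def by auto
  have down: "s \<in> ?K" if "t \<in> ?K" "s \<subseteq> t" for s t using that unfolding Ind_def by (simp add: subset_iff) blast
  have fac: "g = f" if "f \<in> \<Phi>" "g \<in> ?K" "f \<subseteq> g" for f g using cr that unfolding critical_def by simp
  show ne: "{} \<notin> \<Phi>" using fac[OF _ aK] by auto
  have KV: "?K \<subseteq> Pow A" unfolding Ind_def by auto
  interpret facet_family A ?K \<Phi>
  proof
    show "\<Phi> \<subseteq> ?K" using cr unfolding critical_def by simp
  qed (fact A(1) KV down fac ne)+
  have vc: "void_collapsible (?K - \<Phi>)" using cr unfolding critical_def by simp
  have "{} \<in> ?K" using down[OF aK] by simp
  then have nonempty: "?K - \<Phi> \<noteq> {}" using ne by blast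
  have down': "s \<in> ?K - \<Phi>" if "t \<in> ?K - \<Phi>" "s \<subseteq> t" for s t
    using down[of t s] fac[of s t] that by auto
  have sub: "?K - \<Phi> \<subseteq> Pow A" using KV by auto
  obtain fs where "set fs = \<Phi>"
    "realization A ?K homotopy_equivalent_space wedge_of_spheres (map (\<lambda>f. card f - 1) fs)"
    by (rule homotopy_equivalent_wedge_of_spheres[OF
          void_collapsible_imp_contractible[OF vc A(1) sub nonempty down']])
  then show "\<exists>fs. set fs = \<Phi> \<and> realization A (Ind A C) homotopy_equivalent_space wedge_of_spheres (map (\<lambda>f. card f - 1) fs)"
    by blast
qed

text \<open>A facet with \<open>c\<close> vertices yields a sphere of dimension
  \<open>c - 1\<close>, so homology vanishes up to degree \<open>c - 2\<close>. For empty
  \<open>A\<close> the family must contain \<open>{}\<close>, and the bound \<open>-2\<close> agrees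
  with the convention for \<open>{{}}\<close>.\<close>

lemma critical_conn_h_lower:
  assumes A: "finite A" and cr: "critical A \<Psi>" and k: "\<And>g. g \<in> \<Psi> \<Longrightarrow> k \<le> int (card g) - 2"
  shows "ereal (of_int k) \<le> conn_h A (Ind A C)"
proof (cases "A = {}")
  case True
  have "Ind A C = {{}}" using True card_edge two_le_d unfolding Ind_def by fastforce
  then have "void_collapsible ({{}} - \<Psi>)" using cr unfolding critical_def by simp
  moreover have "{{}} - \<Psi> = {{}}" if "{} \<notin> \<Psi>" using that by auto
  ultimately have "{} \<in> \<Psi>" using not_void_collapsible_empty_face by metis
  then have k2: "k \<le> -2" using k[of "{}"] by simp
  have "topspace (realization A (Ind A C)) = {}" unfolding topspace_realization True by simp
  then show ?thesis using k2 by (intro conn_h_lower) (simp add: rhom_vanishes_def)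
next
  case False
  obtain gs where gs: "set gs = \<Psi>" "realization A (Ind A C) homotopy_equivalent_space wedge_of_spheres (map (\<lambda>f. card f - 1) gs)"
    using critical_wedge(2)[OF A False cr] by blast
  show ?thesis
  proof (rule conn_h_lower)
    fix i assume i: "i \<le> k"
    have "i < int (card g - 1)" if "g \<in> set gs" for g
    proof -
      have "k \<le> int (card g) - 2" using k that gs(1) by blast
      then show ?thesis using i by linarith
    qed
    then have "i \<notin> int ` set (map (\<lambda>f. card f - 1) gs)" by force
    then show "rhom_vanishes A (Ind A C) i" unfolding rhom_vanishes_wedge[OF gs(2)] .
  qed
qed

end

theorem theorem1p3:
  fixes V :: "'a set" and C :: "'a set set" and d :: nat
  assumes "hypergraph V C"
    and "uniform d C"
    and "properly_connected d C"
    and "triangulated V d C"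
    and "C \<noteq> {}"
  shows "(\<exists>F\<in>C. conn_h (colon_vertices V C F) (Ind (colon_vertices V C F) (colon_edges C F))
                 \<ge> conn_h V (Ind V C) - ereal (real (card F)) + 1)
       \<and> (contractible_space (realization V (Ind V C))
          \<or> (\<exists>ns. (\<forall>n \<in> set ns. int n \<le> (int d - 1) * int (max_disjoint d C) - 1)
                 \<and> realization V (Ind V C) homotopy_equivalent_space wedge_of_spheres ns))"
proof -
  interpret pc_hypergraph V C d by unfold_locales (fact assms)+
  obtain F \<Phi> \<Psi> where F: "F \<in> C" and \<Phi>: "critical V \<Phi>" and \<Psi>: "critical (colon_vertices V C F) \<Psi>"
    and up: "\<And>g. g \<in> \<Psi> \<Longrightarrow> \<exists>f\<in>\<Phi>. card f = card g + (d - 1)"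
    using ex_critical_colon[OF assms(4,5)] by metis
  let ?B = "colon_vertices V C F"
  have d: "2 \<le> d" using two_le_d[OF F] .
  have V: "V \<noteq> {}" using edge_subset[OF F] card_edge[OF F] d by auto
  have B: "finite ?B" using finite_V unfolding colon_vertices_def by simp
  note wedge = critical_wedge[OF finite_V V \<Phi>]
  obtain fs where fs: "set fs = \<Phi>"
    "realization V (Ind V C) homotopy_equivalent_space wedge_of_spheres (map (\<lambda>f. card f - 1) fs)"
    using wedge(2) by blast
  have pos: "0 < card f" if "f \<in> \<Phi>" for f
  proof -
    have "finite f" using that \<Phi> finite_V unfolding critical_def Ind_def by (auto intro: finite_subset)
    then show ?thesis using wedge(1) that by (auto simp: card_gt_0_iff)
  qed
  have "conn_h V (Ind V C) - ereal (real (card F)) + 1 \<le> conn_h ?B (Ind ?B C)"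
  proof (cases "\<Psi> = {}")
    case True
    \<comment> \<open>Without removed facets every integer is a lower bound, so the connectivity is
      infinite.\<close>
    then have "ereal (of_int k) \<le> conn_h ?B (Ind ?B C)" for k
      using critical_conn_h_lower[OF B \<Psi>] by blast
    then have "ereal (real n) \<le> conn_h ?B (Ind ?B C)" for n by (metis of_int_of_nat_eq)
    then have "conn_h ?B (Ind ?B C) = \<infinity>" by (intro ereal_top) (metis ereal_less_eq(3) order_trans real_arch_simple)
    then show ?thesis by simp
  next
    case False
    then obtain g0 where "g0 \<in> \<Psi>" by auto
    then obtain g where g: "g \<in> \<Psi>" and least: "\<And>h. h \<in> \<Psi> \<Longrightarrow> card g \<le> card h"
      using ex_has_least_nat[of "\<lambda>g. g \<in> \<Psi>" g0 card] by blast
    \<comment> \<open>The smallest facet \<open>g\<close> gives connectivity at least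
      \<open>s - 2\<close> for \<open>C : F\<close>. Its companion \<open>f\<close> gives nonzero
      homology of \<open>Ind V C\<close> in degree \<open>s + d - 2\<close>, hence connectivity at
      most \<open>s + d - 3\<close>; the gap is \<open>d - 1 = card F - 1\<close>.\<close>
    define s where "s = card g"
    obtain f where f: "f \<in> \<Phi>" "card f = s + (d - 1)" using up[OF g] unfolding s_def by blast
    have lower: "ereal (of_int (int s - 2)) \<le> conn_h ?B (Ind ?B C)"
      by (rule critical_conn_h_lower[OF B \<Psi>]) (use least in \<open>simp add: s_def\<close>)
    have "int (card f - 1) \<in> int ` set (map (\<lambda>f. card f - 1) fs)" using f(1) fs(1) by simp
    then have "\<not> rhom_vanishes V (Ind V C) (int (card f - 1))"
      unfolding rhom_vanishes_wedge[OF fs(2)] by blast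
    then have "conn_h V (Ind V C) \<le> ereal (of_int (int (card f - 1) - 1))" by (rule conn_h_upper)
    also have "int (card f - 1) - 1 = int s - 2 + (int d - 1)" using f(2) d by simp
    finally have upper: "conn_h V (Ind V C) \<le> ereal (of_int (int s - 2 + (int d - 1)))" .
    have "conn_h V (Ind V C) - ereal (real (card F)) + 1 \<le> ereal (of_int (int s - 2))"
      using upper card_edge[OF F] by (cases "conn_h V (Ind V C)") (auto simp: one_ereal_def)
    then show ?thesis using lower by (rule order_trans)
  qed
  then have "\<exists>F\<in>C. conn_h (colon_vertices V C F) (Ind (colon_vertices V C F) (colon_edges C F))
      \<ge> conn_h V (Ind V C) - ereal (real (card F)) + 1"
    using F unfolding Ind_colon_edges[OF F, symmetric] by blast
  moreover have "int n \<le> (int d - 1) * int (max_disjoint d C) - 1" if n: "n \<in> set (map (\<lambda>f. card f - 1) fs)" for n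
  proof -
    obtain f where f: "f \<in> \<Phi>" "n = card f - 1" using n fs(1) by auto
    obtain S where S: "S \<subseteq> induced C V" "pairwise_disjoint_dist C (d + 1) S" "card f = (d - 1) * card S"
      using \<Phi> f(1) unfolding critical_def by blast
    have "card S \<le> max_disjoint d C"
      by (rule card_le_max_disjoint) (use S in \<open>auto simp: induced_def\<close>)
    then have "card f \<le> (d - 1) * max_disjoint d C" unfolding S(3) by (rule mult_le_mono2)
    then have "int (card f) \<le> int (d - 1) * int (max_disjoint d C)" by (metis of_nat_le_iff of_nat_mult)
    moreover have "int (d - 1) = int d - 1" using d by simp
    \<comment> \<open>Since \<open>f\<close> is nonempty, the subtraction in
      \<open>n = card f - 1\<close> is not truncated.\<close>
    ultimately show ?thesis using f(2) pos[OF f(1)] by simp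
  qed
  \<comment> \<open>An empty \<open>fs\<close> gives a point, so the wedge alternative also covers
    the contractible case.\<close>
  ultimately show ?thesis using fs(2) by blast
qed

end
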